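(* Let $c>0$, let $F$ be the limiting spectral distribution, on the imaginary axis, of $S_n=\frac1n(Z_1Z_2^*-Z_2Z_1^* )$ described in the context (the case of identity covariance), and let $\tilde F$ be the distribution of the real random variable $Y$ such that $\mathrm{i}Y\sim F$. Then $\tilde F$ is differentiable at every $x\ne0$, with derivative $$f_c(x)=\frac{\sqrt3}{2\pi}\Big((V_+(x))^{1/3}-(V_-(x))^{1/3}\Big)1_{\{x\in S_c\}},\qquad V_\pm(x):=|r(x)|\pm\sqrt{-d(x)},$$ where $r$, $d$ and $S_c$ are the explicit functions and set given in the context (the expression being read as $0$ for $x\notin S_c$). At $x=0$, the derivative exists when $0<c<2$ and is given by $$f_c(0)=\frac{1}{\pi\sqrt{2c-c^2}}.$$ The density $f_c$ is continuous wherever it exists.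
   Context: $\mathrm{i}=\sqrt{-1}$; $\mathbb{C}_L=\{\Re z<0\}$, $\mathbb{C}_R=\{\Re z>0\}$. The distribution $F$: let $p/n\to c\in(0,\infty)$ and let $Z_1,Z_2\in\mathbb{C}^{p\times n}$ be independent random matrices with independent entries of zero mean, unit variance and uniformly bounded moments of order $4+\eta_0$ for some $\eta_0>0$. The empirical spectral distribution of the skew-Hermitian matrix $S_n=\frac1n(Z_1Z_2^*-Z_2Z_1^* )$ (mass $1/p$ at each of its purely imaginary eigenvalues) converges weakly, almost surely, to a non-random probability distribution $F=F_c$ on the imaginary axis. $F$ is characterised by its Stieltjes transform $s_F(z)=\int_{\mathbb{R}}\frac{F(dt)}{\mathrm{i}t-z}$ ($F(dt)$ referring to the mass at $\mathrm{i}t$), which for each $z\in\mathbb{C}_L$ is the unique $m\in\mathbb{C}_R$ satisfying $\frac1m=-z+\frac{1}{\mathrm{i}+cm}+\frac{1}{-\mathrm{i}+cm}$; equivalently, the unique root with positive real part of $c^2zm^3+(c^2-2c)m^2+zm+1=0$. Parameters: $r_1=-\frac{c+1}{3c^3}$, $r_3=-\frac{(c-2)^3}{27c^3}$, $R(z)=\frac{r_1}{z}+\frac{r_3}{z^3}$ for $z\neq0$, and $r(x)=\lim_{\epsilon\downarrow0}R(-\epsilon+\mathrm{i}x)$ for real $x\ne0$. $d_0=\frac{1}{27c^6}$, $d_2=\frac{2c^2+10c-1}{27c^6}$, $d_4=\frac{(1-2/c)^3}{27c^2}$, and $d(x)=d_0-\frac{d_2}{x^2}+\frac{d_4}{x^4}$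 for $x\neq0$. $R_\pm=\frac{d_2\pm\sqrt{d_2^2-4d_0d_4}}{2d_0}$ (these are real), $L_c=\sqrt{R_-1_{\{R_->0\}}}$, $U_c=\sqrt{R_+}$, and $S_c=(-U_c,-L_c)\cup(L_c,U_c)$. *)

theory Defs
  imports
    "HOL-Probability.Probability"
    "HOL-Computational_Algebra.Fundamental_Theorem_Algebra"
    "Jordan_Normal_Form.Char_Poly"
    "Jordan_Normal_Form.Schur_Decomposition"
begin

text \<open>The random matrix ensemble. For every \<open>n\<close> the matrices \<open>Z1 n\<close> and \<open>Z2 n\<close> are of size
  \<open>p n \<times> n\<close>; within a fixed \<open>n\<close> all entries of both are jointly independent, while nothing is
  assumed about the joint law for different \<open>n\<close>. The entries need not be identically distributed.\<close>

definition skew_ensemble ::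
  "real \<Rightarrow> 'w measure \<Rightarrow> (nat \<Rightarrow> nat) \<Rightarrow> (nat \<Rightarrow> 'w \<Rightarrow> complex mat) \<Rightarrow> (nat \<Rightarrow> 'w \<Rightarrow> complex mat) \<Rightarrow> bool"
where
  "skew_ensemble c M p Z1 Z2 \<longleftrightarrow>
     prob_space M \<and>
     (\<lambda>n. real (p n) / real n) \<longlonglongrightarrow> c \<and>
     (\<forall>n. \<forall>\<omega>\<in>space M. Z1 n \<omega> \<in> carrier_mat (p n) n \<and> Z2 n \<omega> \<in> carrier_mat (p n) n) \<and>
     (\<forall>n. prob_space.indep_vars M (\<lambda>_. borel)
            (\<lambda>(b, i, j) \<omega>. (if b then Z1 n \<omega> else Z2 n \<omega>) $$ (i, j))
            (UNIV \<times> {..<p n} \<times> {..<n})) \<and>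
     (\<forall>Z\<in>{Z1, Z2}. \<forall>n. \<forall>i<p n. \<forall>j<n.
        integral\<^sup>L M (\<lambda>\<omega>. Z n \<omega> $$ (i, j)) = 0 \<and>
        integral\<^sup>L M (\<lambda>\<omega>. (cmod (Z n \<omega> $$ (i, j)))\<^sup>2) = 1) \<and>
     (\<exists>\<eta>>0. \<exists>B. \<forall>Z\<in>{Z1, Z2}. \<forall>n. \<forall>i<p n. \<forall>j<n.
        integrable M (\<lambda>\<omega>. cmod (Z n \<omega> $$ (i, j)) powr (4 + \<eta>)) \<and>
        integral\<^sup>L M (\<lambda>\<omega>. cmod (Z n \<omega> $$ (i, j)) powr (4 + \<eta>)) \<le> B)"

definition skew_matrix :: "nat \<Rightarrow> complex mat \<Rightarrow> complex mat \<Rightarrow> complex mat" where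
  "skew_matrix n A B = (1 / of_nat n) \<cdot>\<^sub>m (A * mat_adjoint B - B * mat_adjoint A)"

text \<open>Eigenvalues are counted with algebraic multiplicity. For a matrix of size \<open>0\<close> the value is
  meaningless.\<close>

definition empirical_spectral_distribution :: "complex mat \<Rightarrow> complex pmf" where
  "empirical_spectral_distribution A = pmf_of_multiset (proots (char_poly A))"

text \<open>All measures involved live on the imaginary axis, which \<open>Im\<close> maps homeomorphically onto the
  real line, so weak convergence may be expressed by the library's notion on the reals.\<close>

definition limiting_spectral_distribution ::
  "'w measure \<Rightarrow> (nat \<Rightarrow> 'w \<Rightarrow> complex mat) \<Rightarrow> complex measure \<Rightarrow> bool" where
  "limiting_spectral_distribution M S F \<longleftrightarrow>
     (AE \<omega> in M. weak_conv_m
        (\<lambda>n. distr (measure_pmf (empirical_spectral_distribution (S n \<omega>))) borel Im)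
        (distr F borel Im))"

definition stieltjes_transform :: "complex measure \<Rightarrow> complex \<Rightarrow> complex" where
  "stieltjes_transform F z = integral\<^sup>L F (\<lambda>w. 1 / (w - z))"

definition stieltjes_equation :: "real \<Rightarrow> complex \<Rightarrow> complex \<Rightarrow> bool" where
  "stieltjes_equation c z m \<longleftrightarrow>
     1 / m = - z + 1 / (\<i> + of_real c * m) + 1 / (- \<i> + of_real c * m)"

text \<open>Clearing denominators in the equation above gives a cubic in \<open>m\<close>; once it is
  made monic, its coefficients of \<open>m\<^sup>2\<close>, \<open>m\<close> and \<open>1\<close> are \<open>(1 - 2 / c) / z\<close>, \<open>1 / c\<^sup>2\<close> and
  \<open>1 / (c\<^sup>2 * z)\<close>. \<open>cubic_R\<close> and
  \<open>disc_d\<close> are the quantities \<open>R\<close> and \<open>Q\<^sup>3 + R\<^sup>2\<close> of Cardano's formula, the second taken at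
  \<open>z = \<i> * x\<close>.\<close>

definition cubic_r1 :: "real \<Rightarrow> real" where
  "cubic_r1 c = - (c + 1) / (3 * c ^ 3)"

definition cubic_r3 :: "real \<Rightarrow> real" where
  "cubic_r3 c = - ((c - 2) ^ 3) / (27 * c ^ 3)"

definition cubic_R :: "real \<Rightarrow> complex \<Rightarrow> complex" where
  "cubic_R c z = of_real (cubic_r1 c) / z + of_real (cubic_r3 c) / z ^ 3"

definition cubic_r :: "real \<Rightarrow> real \<Rightarrow> complex" where
  "cubic_r c x = Lim (at_right 0) (\<lambda>\<epsilon>. cubic_R c (of_real (- \<epsilon>) + \<i> * of_real x))"

definition disc_d0 :: "real \<Rightarrow> real" where
  "disc_d0 c = 1 / (27 * c ^ 6)"

definition disc_d2 :: "real \<Rightarrow> real" where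
  "disc_d2 c = (2 * c\<^sup>2 + 10 * c - 1) / (27 * c ^ 6)"

definition disc_d4 :: "real \<Rightarrow> real" where
  "disc_d4 c = (1 - 2 / c) ^ 3 / (27 * c\<^sup>2)"

definition disc_d :: "real \<Rightarrow> real \<Rightarrow> real" where
  "disc_d c x = disc_d0 c - disc_d2 c / x\<^sup>2 + disc_d4 c / x ^ 4"

definition R_plus :: "real \<Rightarrow> real" where
  "R_plus c = (disc_d2 c + sqrt ((disc_d2 c)\<^sup>2 - 4 * disc_d0 c * disc_d4 c)) / (2 * disc_d0 c)"

definition R_minus :: "real \<Rightarrow> real" where
  "R_minus c = (disc_d2 c - sqrt ((disc_d2 c)\<^sup>2 - 4 * disc_d0 c * disc_d4 c)) / (2 * disc_d0 c)"

definition L_edge :: "real \<Rightarrow> real" where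
  "L_edge c = sqrt (R_minus c * indicator {0<..} (R_minus c))"

definition U_edge :: "real \<Rightarrow> real" where
  "U_edge c = sqrt (R_plus c)"

definition support_set :: "real \<Rightarrow> real set" where
  "support_set c = {- U_edge c <..< - L_edge c} \<union> {L_edge c <..< U_edge c}"

definition V_plus :: "real \<Rightarrow> real \<Rightarrow> real" where
  "V_plus c x = cmod (cubic_r c x) + sqrt (- disc_d c x)"

definition V_minus :: "real \<Rightarrow> real \<Rightarrow> real" where
  "V_minus c x = cmod (cubic_r c x) - sqrt (- disc_d c x)"

text \<open>Only meaningful for \<open>x \<noteq> 0\<close>. Outside \<^term>\<open>support_set c\<close> the square root of a possibly
  negative number (an odd function in HOL) is multiplied by zero.\<close>

definition limit_density :: "real \<Rightarrow> real \<Rightarrow> real" where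
  "limit_density c x =
     sqrt 3 / (2 * pi) * (root 3 (V_plus c x) - root 3 (V_minus c x)) * indicator (support_set c) x"

end

theory Submission
  imports Defs
begin

text \<open>Write \<open>s\<close> for the Stieltjes transform. At \<open>z = \<i> x - \<epsilon>\<close> its real part is the Poisson integral of
  \<open>Ft\<close>, so it suffices to find its boundary values as \<open>\<epsilon> \<rightarrow> 0\<close> and to bound it locally: Fubini and
  dominated convergence then show that \<open>cdf Ft\<close> is a primitive of the boundary values divided by \<open>pi\<close>.
  At \<open>z = \<i> x\<close>, \<open>x \<noteq> 0\<close>, the cubic is real in the variable \<open>\<i> m\<close>. Where its discriminant gives a
  nonreal pair, Cardano's formula yields a root \<open>m\<close> with positive real part; it persists for nearby
  \<open>z\<close> and is therefore the limit of \<open>s z\<close>, because \<open>s z\<close> is the only root with positive real part.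
  Otherwise all roots at \<open>\<i> x\<close> are imaginary, which forces \<open>Re (s z) \<rightarrow> 0\<close>. For \<open>c < 2\<close> the same
  argument at \<open>z = 0\<close> applies to the cubic of \<open>1 / m\<close>; for \<open>c \<ge> 2\<close> the growth of \<open>s (- \<epsilon>)\<close> excludes
  differentiability at \<open>0\<close>.\<close>

subsection \<open>Inversion of Poisson integrals\<close>

text \<open>The kernel is the Poisson kernel of a half-plane without its factor
  \<open>1 / pi\<close>. In this normalisation it is exactly the real part of the Stieltjes
  transform, and boundary values are \<open>pi\<close> times a density.\<close>

definition poisson_integral :: "real measure \<Rightarrow> real \<Rightarrow> real \<Rightarrow> real" where
  "poisson_integral M \<epsilon> x = (\<integral>t. \<epsilon> / (\<epsilon>\<^sup>2 + (x - t)\<^sup>2) \<partial>M)"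

lemma poisson_kernel_bounds:
  fixes \<epsilon> s :: real
  assumes "\<epsilon> > 0"
  shows "0 < \<epsilon> / (\<epsilon>\<^sup>2 + s\<^sup>2)" "\<epsilon> / (\<epsilon>\<^sup>2 + s\<^sup>2) \<le> 1 / \<epsilon>"
proof -
  have pos: "\<epsilon>\<^sup>2 + s\<^sup>2 > 0" using assms by (intro add_pos_nonneg) auto
  then show "0 < \<epsilon> / (\<epsilon>\<^sup>2 + s\<^sup>2)" using assms by simp
  have "\<epsilon> / (\<epsilon>\<^sup>2 + s\<^sup>2) \<le> \<epsilon> / \<epsilon>\<^sup>2" using assms pos by (intro divide_left_mono mult_pos_pos) auto
  then show "\<epsilon> / (\<epsilon>\<^sup>2 + s\<^sup>2) \<le> 1 / \<epsilon>" using assms by (simp add: power2_eq_square)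
qed

context real_distribution
begin

lemma integrable_poisson_kernel:
  "\<epsilon> > 0 \<Longrightarrow> integrable M (\<lambda>t. \<epsilon> / (\<epsilon>\<^sup>2 + (x - t)\<^sup>2))"
  using poisson_kernel_bounds[of \<epsilon> "x - _"]
  by (intro integrable_const_bound[where B = "1 / \<epsilon>"]) (auto intro!: AE_I2 simp: abs_of_nonneg less_imp_le)

lemma borel_measurable_poisson_integral [measurable]:
  "poisson_integral M \<epsilon> \<in> borel_measurable borel"
  unfolding poisson_integral_def by measurable

lemma poisson_integral_nonneg: "\<epsilon> > 0 \<Longrightarrow> poisson_integral M \<epsilon> x \<ge> 0"
  unfolding poisson_integral_def using poisson_kernel_bounds(1)[of \<epsilon> "x - _"]
  by (intro integral_nonneg_AE AE_I2) (auto intro: less_imp_le)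

text \<open>The kernel is bounded by \<open>1 / \<epsilon>\<close> on a set of finite product
  measure, so Fubini applies, and \<open>arctan ((x - t) / \<epsilon>)\<close> is a primitive of the
  kernel in \<open>x\<close>.\<close>

lemma integral_poisson_integral:
  assumes "\<epsilon> > 0" "a \<le> b"
  shows "(\<integral>x. poisson_integral M \<epsilon> x * indicator {a..b} x \<partial>lborel)
       = (\<integral>t. arctan ((b - t) / \<epsilon>) - arctan ((a - t) / \<epsilon>) \<partial>M)"
proof -
  have sigma_finite_M: "sigma_finite_measure M" ..
  interpret pair_sigma_finite lborel M ..
  let ?f = "\<lambda>x t. \<epsilon> / (\<epsilon>\<^sup>2 + (x - t)\<^sup>2) * indicator {a..b} x"
  have "integrable (lborel \<Otimes>\<^sub>M M) (case_prod ?f)"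
  proof (rule integrableI_bounded_set[where A = "{a..b} \<times> space M" and B = "1 / \<epsilon>"])
    show "emeasure (lborel \<Otimes>\<^sub>M M) ({a..b} \<times> space M) < \<infinity>"
      by (subst sigma_finite_measure.emeasure_pair_measure_Times[OF sigma_finite_M])
        (use assms(2) emeasure_space_1 in auto)
    show "AE x in lborel \<Otimes>\<^sub>M M. x \<in> {a..b} \<times> space M \<longrightarrow> norm (case_prod ?f x) \<le> 1 / \<epsilon>"
      using poisson_kernel_bounds[OF assms(1)] assms(1)
      by (intro AE_I2) (auto simp: indicator_def)
  qed (auto simp: indicator_def space_pair_measure)
  then have "(\<integral>x. (\<integral>t. ?f x t \<partial>M) \<partial>lborel) = (\<integral>t. (\<integral>x. ?f x t \<partial>lborel) \<partial>M)"
    by (rule Fubini_integral[symmetric])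
  moreover have "(\<integral>x. ?f x t \<partial>lborel) = arctan ((b - t) / \<epsilon>) - arctan ((a - t) / \<epsilon>)" for t
  proof (rule integral_FTC_Icc_real[OF assms(2)])
    fix x
    have nz: "\<epsilon>\<^sup>2 + (x - t)\<^sup>2 \<noteq> 0" using assms(1) by (simp add: sum_power2_eq_zero_iff)
    have "inverse (1 + ((x - t) / \<epsilon>)\<^sup>2) * (1 / \<epsilon>) = \<epsilon> / (\<epsilon>\<^sup>2 + (x - t)\<^sup>2)"
      using assms(1) nz by (simp add: field_simps power2_eq_square)
    moreover have "((\<lambda>x. arctan ((x - t) / \<epsilon>)) has_real_derivative
        inverse (1 + ((x - t) / \<epsilon>)\<^sup>2) * (1 / \<epsilon>)) (at x)"
      using assms(1) by (auto intro!: derivative_eq_intros simp: field_simps)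
    ultimately show "((\<lambda>x. arctan ((x - t) / \<epsilon>)) has_real_derivative \<epsilon> / (\<epsilon>\<^sup>2 + (x - t)\<^sup>2)) (at x)"
      by simp
    show "isCont (\<lambda>x. \<epsilon> / (\<epsilon>\<^sup>2 + (x - t)\<^sup>2)) x" using nz by (intro continuous_intros) auto
  qed
  moreover have "(\<integral>t. ?f x t \<partial>M) = poisson_integral M \<epsilon> x * indicator {a..b} x" for x
    unfolding poisson_integral_def by (rule integral_mult_left_zero)
  ultimately show ?thesis by (simp only:)
qed

end

lemma arctan_divide_tendsto_sgn:
  "((\<lambda>\<epsilon>. arctan (s / \<epsilon>)) \<longlongrightarrow> pi / 2 * sgn s) (at_right 0)"
proof -
  have inv: "filterlim (\<lambda>\<epsilon>::real. inverse \<epsilon>) at_top (at_right 0)"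
    by (rule filterlim_inverse_at_top_right)
  consider "s > 0" | "s = 0" | "s < 0" by linarith
  then show ?thesis
  proof cases
    case 1
    have "filterlim (\<lambda>\<epsilon>. s * inverse \<epsilon>) at_top (at_right 0)"
      by (rule filterlim_tendsto_pos_mult_at_top[OF tendsto_const 1 inv])
    from filterlim_compose[OF tendsto_arctan_at_top this] show ?thesis
      using 1 by (simp add: divide_inverse[of s])
  next
    case 3
    have "filterlim (\<lambda>\<epsilon>. s * inverse \<epsilon>) at_bot (at_right 0)"
      by (rule filterlim_tendsto_neg_mult_at_bot[OF tendsto_const 3 inv])
    from filterlim_compose[OF tendsto_arctan_at_bot this] show ?thesis
      using 3 by (simp add: divide_inverse[of s])
  qed simp
qed

context real_distribution
begin

text \<open>Both sides of \<open>integral_poisson_integral\<close> converge as \<epsilon> tends to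
  0: one is dominated by \<open>B\<close>, the other by \<open>pi\<close>. For \<open>a < b\<close>
  the limiting integrand on the left is the indicator of the interval with value 1/2 at both
  endpoints, so atoms need not be excluded yet.\<close>

lemma integral_sgn_eq_boundary_integral:
  assumes "a \<le> b" "e > 0"
    and bound: "\<And>\<epsilon> x. 0 < \<epsilon> \<Longrightarrow> \<epsilon> < e \<Longrightarrow> x \<in> {a..b} \<Longrightarrow> poisson_integral M \<epsilon> x \<le> B"
    and lim: "AE x in lborel. x \<in> {a..b} \<longrightarrow> ((\<lambda>\<epsilon>. poisson_integral M \<epsilon> x) \<longlongrightarrow> pi * g x) (at_right 0)"
    and cont: "continuous_on {a..b} g"
  shows "(\<integral>t. (sgn (b - t) - sgn (a - t)) / 2 \<partial>M) = (\<integral>x. g x * indicator {a..b} x \<partial>lborel)"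
proof -
  \<comment> \<open>Dominated convergence is applied along a sequence; \<open>Suc n\<close> keeps
    even the first term strictly below \<open>e\<close>.\<close>
  define X where "X n = e * (1 / 2) ^ Suc n" for n
  have X: "0 < X n" "X n < e" for n
    using assms(2) power_Suc_less_one[of "1 / 2 :: real" n] by (auto simp: X_def simp del: power_Suc)
  have "X \<longlonglongrightarrow> 0"
    unfolding X_def by (intro tendsto_mult_right_zero LIMSEQ_Suc LIMSEQ_realpow_zero) auto
  then have X0: "filterlim X (at_right 0) sequentially"
    using X(1) by (intro tendsto_imp_filterlim_at_right) auto
  have gm: "(\<lambda>x. pi * g x * indicator {a..b} x) \<in> borel_measurable lborel"
    using borel_measurable_continuous_on_indicator[OF _ cont] by (simp add: mult.assoc mult.commute)
  have "(\<lambda>n. \<integral>x. poisson_integral M (X n) x * indicator {a..b} x \<partial>lborel)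
      \<longlonglongrightarrow> (\<integral>x. pi * g x * indicator {a..b} x \<partial>lborel)"
  proof (rule integral_dominated_convergence[where w = "\<lambda>x. B * indicator {a..b} x"])
    show "AE x in lborel. (\<lambda>n. poisson_integral M (X n) x * indicator {a..b} x) \<longlonglongrightarrow> pi * g x * indicator {a..b} x"
      using lim
    proof eventually_elim
      case (elim x)
      show ?case
      proof (cases "x \<in> {a..b}")
        case True
        then show ?thesis using filterlim_compose[OF _ X0] elim by simp
      qed simp
    qed
    show "AE x in lborel. norm (poisson_integral M (X n) x * indicator {a..b} x) \<le> B * indicator {a..b} x" for n
      using bound[OF X] poisson_integral_nonneg[OF X(1)] by (intro AE_I2) (auto simp: indicator_def)
  qed (use gm assms(1) in \<open>auto intro!: integrable_mult_right integrable_real_indicator\<close>)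
  moreover have "(\<lambda>n. \<integral>t. arctan ((b - t) / X n) - arctan ((a - t) / X n) \<partial>M)
      \<longlonglongrightarrow> (\<integral>t. pi / 2 * sgn (b - t) - pi / 2 * sgn (a - t) \<partial>M)"
  proof (rule integral_dominated_convergence[where w = "\<lambda>x. pi"])
    show "AE t in M. (\<lambda>n. arctan ((b - t) / X n) - arctan ((a - t) / X n))
        \<longlonglongrightarrow> pi / 2 * sgn (b - t) - pi / 2 * sgn (a - t)"
      using filterlim_compose[OF arctan_divide_tendsto_sgn X0]
      by (intro AE_I2 tendsto_diff) auto
    have "norm (arctan u - arctan v) \<le> pi" for u v
      using arctan_bounded[of u] arctan_bounded[of v] by (simp add: abs_le_iff)
    then show "AE t in M. norm (arctan ((b - t) / X n) - arctan ((a - t) / X n)) \<le> pi" for n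
      by (intro AE_I2)
  qed auto
  ultimately have "(\<integral>x. pi * g x * indicator {a..b} x \<partial>lborel)
      = (\<integral>t. pi / 2 * sgn (b - t) - pi / 2 * sgn (a - t) \<partial>M)"
    unfolding integral_poisson_integral[OF X(1) assms(1)] by (rule LIMSEQ_unique)
  also have "(\<lambda>t. pi / 2 * sgn (b - t) - pi / 2 * sgn (a - t)) = (\<lambda>t. pi * ((sgn (b - t) - sgn (a - t)) / 2))"
    by (simp add: fun_eq_iff field_simps)
  also have "(\<lambda>x. pi * g x * indicator {a..b} x) = (\<lambda>x. pi * (g x * indicator {a..b} x))"
    by (simp add: fun_eq_iff)
  finally show ?thesis unfolding integral_mult_right_zero by (metis mult_cancel_left pi_neq_zero)
qed

lemma integrable_sgn_diff: "integrable M (\<lambda>t. (sgn (b - t) - sgn (a - t)) / 2)" for a b :: real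
  by (rule integrable_const_bound[where B = 1]) (auto intro!: AE_I2 simp: sgn_if)

text \<open>Increments of the cdf turn out to be integrals of \<open>g\<close>, and the fundamental
  theorem of calculus finishes. The boundary limit is asked only almost everywhere, so that an
  interval around 0 can be treated with the limits at its nonzero points; the bound, in contrast, is
  uniform.\<close>

theorem stieltjes_inversion_cdf:
  assumes "e > 0"
    and bound: "\<And>\<epsilon> x. 0 < \<epsilon> \<Longrightarrow> \<epsilon> < e \<Longrightarrow> x \<in> {a..b} \<Longrightarrow> poisson_integral M \<epsilon> x \<le> B"
    and lim: "AE x in lborel. x \<in> {a..b} \<longrightarrow> ((\<lambda>\<epsilon>. poisson_integral M \<epsilon> x) \<longlongrightarrow> pi * g x) (at_right 0)"
    and cont: "continuous_on {a..b} g"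
    and x: "x \<in> {a<..<b}"
  shows "(cdf M has_real_derivative g x) (at x)"
proof -
  have int_sgn: "(\<integral>t. (sgn (b' - t) - sgn (a' - t)) / 2 \<partial>M) = integral {a'..b'} g"
    if "a \<le> a'" "a' \<le> b'" "b' \<le> b" for a' b'
  proof -
    have sub: "{a'..b'} \<subseteq> {a..b}" using that by auto
    have "(\<integral>t. (sgn (b' - t) - sgn (a' - t)) / 2 \<partial>M) = (\<integral>x. g x * indicator {a'..b'} x \<partial>lborel)"
      using lim sub that assms(1)
      by (intro integral_sgn_eq_boundary_integral[where e = e and B = B] bound continuous_on_subset[OF cont])
         (auto elim!: eventually_mono)
    also have "\<dots> = (LINT x : {a'..b'} | lborel. g x)"
      by (simp add: set_lebesgue_integral_def mult.commute)
    also have "\<dots> = integral {a'..b'} g"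
      using borel_integrable_atLeastAtMost'[OF continuous_on_subset[OF cont sub]]
      by (rule set_borel_integral_eq_integral)
    finally show ?thesis .
  qed
  obtain G where G: "\<And>y. y \<in> {a..b} \<Longrightarrow> norm (g y) \<le> G"
    using compact_imp_bounded[OF compact_continuous_image[OF cont compact_Icc]]
    by (metis bounded_iff imageI)
  \<comment> \<open>The integrand of \<open>int_sgn\<close> equals 1 at the midpoint of an interval,
    so an atom at \<open>y\<close> is at most the integral of \<open>g\<close> over
    \<open>[y - \<delta>, y + \<delta>]\<close>, which is O(\<delta>).\<close>
  have no_atom: "measure M {y} = 0" if y: "y \<in> {a<..<b}" for y
  proof (rule antisym)
    show "measure M {y} \<le> 0"
    proof (rule tendsto_lowerbound)
      show "((\<lambda>\<delta>. G * ((y + \<delta>) - (y - \<delta>))) \<longlongrightarrow> 0) (at_right 0)"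
        by (auto intro!: tendsto_eq_intros)
      have "eventually (\<lambda>\<delta>. \<delta> \<in> {0<..<min (y - a) (b - y)}) (at_right 0)"
        using y by (intro eventually_at_right_real) auto
      then show "\<forall>\<^sub>F \<delta> in at_right 0. measure M {y} \<le> G * ((y + \<delta>) - (y - \<delta>))"
      proof eventually_elim
        case (elim \<delta>)
        have "measure M {y} = (\<integral>t. indicator {y} t \<partial>M)" by simp
        also have "\<dots> \<le> (\<integral>t. (sgn (y + \<delta> - t) - sgn (y - \<delta> - t)) / 2 \<partial>M)"
          using elim by (intro integral_mono integrable_sgn_diff integrable_real_indicator)
            (auto simp: indicator_def sgn_if emeasure_eq_measure)
        also have "\<dots> = integral {y - \<delta>..y + \<delta>} g" using elim by (intro int_sgn) auto
        also have "\<dots> \<le> G * ((y + \<delta>) - (y - \<delta>))"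
          using elim G integral_bound[of "y - \<delta>" "y + \<delta>" g G] continuous_on_subset[OF cont, of "{y - \<delta>..y + \<delta>}"]
          by force
        finally show ?case .
      qed
    qed auto
  qed simp
  \<comment> \<open>Atoms are excluded only strictly between \<open>a\<close> and \<open>b\<close>;
    the base point of the primitive therefore moves inside.\<close>
  define a' where "a' = (a + x) / 2"
  define b' where "b' = (b + x) / 2"
  have ab: "a < a'" "a' < x" "x < b'" "b' < b" using x by (auto simp: a'_def b'_def)
  have cdf: "cdf M y = cdf M a' + integral {a'..y} g" if "y \<in> {a'<..<b'}" for y
  proof -
    have "cdf M y - cdf M a' = measure M {a'<..y}" using that by (intro cdf_diff_eq) auto
    also have "\<dots> = (\<integral>t. indicator {a'<..y} t \<partial>M)" by simp
    also have "\<dots> = (\<integral>t. (sgn (y - t) - sgn (a' - t)) / 2 \<partial>M)"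
    \<comment> \<open>The integrands differ only at \<open>a'\<close> and \<open>y\<close>, where
      the second one is 1/2; both points are null.\<close>
    proof (rule integral_cong_AE)
      have "AE t in M. t \<noteq> y" "AE t in M. t \<noteq> a'"
        using no_atom[of y] no_atom[of a'] that ab
        by (auto intro!: AE_I[where N = "{_}"] simp: emeasure_eq_measure)
      then show "AE t in M. indicator {a'<..y} t = (sgn (y - t) - sgn (a' - t)) / 2"
        by eventually_elim (use that in \<open>auto simp: indicator_def sgn_if\<close>)
    qed auto
    also have "\<dots> = integral {a'..y} g" using that ab by (intro int_sgn) auto
    finally show ?thesis by simp
  qed
  have "((\<lambda>y. integral {a'..y} g) has_real_derivative g x) (at x within {a'..b'})"
    using ab by (intro integral_has_real_derivative continuous_on_subset[OF cont]) auto
  then have "((\<lambda>y. integral {a'..y} g) has_real_derivative g x) (at x)"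
    using ab by (simp add: at_within_Icc_at)
  then have "((\<lambda>y. cdf M a' + integral {a'..y} g) has_real_derivative g x) (at x)"
    by (auto intro!: derivative_eq_intros)
  then show ?thesis
    by (rule DERIV_cong_ev[THEN iffD1, rotated -1])
       (use ab cdf in \<open>auto intro!: eventually_mono[OF eventually_nhds_in_open[of "{a'<..<b'}"]]\<close>)
qed

end

text \<open>A derivative at 0 gives intervals of radius h around 0 mass O(h). With \<epsilon> = k^6
  the resulting bound has order \<epsilon>^(-1/6): not optimal, but smaller than the order
  \<epsilon>^(-1/3) that the cubic enforces for \<open>c \<ge> 2\<close>. The sixth power makes all
  scales integer powers of \<open>k\<close>.\<close>

lemma (in real_distribution) poisson_integral_bound_of_cdf_differentiable:
  assumes "cdf M differentiable (at 0)"
  obtains K where "K > 0" "eventually (\<lambda>k. poisson_integral M (k ^ 6) 0 \<le> K / k) (at_right 0)"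
proof -
  obtain D where D: "(cdf M has_real_derivative D) (at 0)"
    using assms by (auto simp: real_differentiable_def)
  then have "((\<lambda>h. (cdf M h - cdf M 0) / h) \<longlongrightarrow> D) (at 0)"
    by (simp add: DERIV_def)
  then have "((\<lambda>h. \<bar>(cdf M h - cdf M 0) / h\<bar>) \<longlongrightarrow> \<bar>D\<bar>) (at 0)" by (rule tendsto_rabs)
  then have "eventually (\<lambda>h. \<bar>(cdf M h - cdf M 0) / h\<bar> < \<bar>D\<bar> + 1) (at 0)"
    by (rule order_tendstoD) simp
  then obtain d where d: "d > 0" "\<And>h. h \<noteq> 0 \<Longrightarrow> \<bar>h\<bar> < d \<Longrightarrow> \<bar>(cdf M h - cdf M 0) / h\<bar> < \<bar>D\<bar> + 1"
    by (auto simp: eventually_at)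
  \<comment> \<open>Near 0 the difference quotient is below \<open>\<bar>D\<bar> + 1\<close>; the
    factor 2 adds up the two halves of a symmetric interval.\<close>
  define K where "K = 2 * (\<bar>D\<bar> + 1)"
  have lip: "\<bar>cdf M h - cdf M 0\<bar> \<le> (\<bar>D\<bar> + 1) * \<bar>h\<bar>" if "h \<noteq> 0" "\<bar>h\<bar> < d" for h
    using d(2)[OF that] that(1) by (simp add: abs_divide divide_less_eq)
  have meas: "measure M {-h<..h} \<le> K * h" if "0 < h" "h < d" for h
    using lip[of h] lip[of "-h"] that cdf_diff_eq[of "-h" h] by (auto simp: K_def algebra_simps abs_le_iff)
  have "eventually (\<lambda>k. k \<in> {0<..<min 1 d}) (at_right 0)"
    using d(1) by (intro eventually_at_right_real) auto
  then have "eventually (\<lambda>k. poisson_integral M (k ^ 6) 0 \<le> (2 * K + 1) / k) (at_right 0)"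
  proof eventually_elim
    case (elim k)
    then have k: "0 < k" "k < 1" "k < d" by auto
    have "k ^ 3 \<le> k" "k ^ 5 \<le> k" using power_decreasing[of 1 _ k] k by auto
    then have kd: "k ^ 3 < d" "k ^ 5 < d" using k(3) by linarith+
    \<comment> \<open>Splitting at the single scale \<open>k\<^sup>4\<close> would only give \<open>K / k\<^sup>2\<close>, too weak for \<open>c = 2\<close>.\<close>
    let ?w = "\<lambda>t. 1 / k ^ 6 * indicator {-(k^5)<..k^5} t + 1 / k ^ 4 * indicator {-(k^3)<..k^3} t + (1::real)"
    have int: "integrable M ?w"
      by (intro Bochner_Integration.integrable_add integrable_mult_right integrable_real_indicator) (auto simp: emeasure_eq_measure)
    have "poisson_integral M (k ^ 6) 0 \<le> (\<integral>t. ?w t \<partial>M)"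
      unfolding poisson_integral_def
    proof (intro integral_mono integrable_poisson_kernel int)
      fix t
      \<comment> \<open>Outside radius \<open>a\<close> the kernel is at most
        \<open>k ^ 6 / a\<^sup>2\<close>, that is \<open>1 / k ^ 4\<close> for
        \<open>a = k ^ 5\<close> and 1 for \<open>a = k ^ 3\<close>; these are the weights in
        \<open>?w\<close>.\<close>
      have far: "k ^ 6 / ((k ^ 6)\<^sup>2 + (0 - t)\<^sup>2) \<le> k ^ 6 / (a ^ 2)" if "0 < a" "t \<notin> {-a<..a}" for a
      proof (intro divide_left_mono mult_pos_pos)
        have "a ^ 2 \<le> t ^ 2" using that by (intro abs_le_square_iff[THEN iffD1]) auto
        then show "a ^ 2 \<le> (k ^ 6)\<^sup>2 + (0 - t)\<^sup>2" using k(1) by (simp add: add_increasing)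
        show "0 < (k ^ 6)\<^sup>2 + (0 - t)\<^sup>2" using k(1) by (intro add_pos_nonneg) auto
      qed (use k that in auto)
      consider "t \<in> {-(k^5)<..k^5}" | "t \<notin> {-(k^5)<..k^5}" "t \<in> {-(k^3)<..k^3}" | "t \<notin> {-(k^3)<..k^3}" by blast
      then show "k ^ 6 / ((k ^ 6)\<^sup>2 + (0 - t)\<^sup>2) \<le> ?w t"
      proof cases
        case 1
        have "k ^ 6 / ((k ^ 6)\<^sup>2 + (0 - t)\<^sup>2) \<le> 1 / k ^ 6" using k by (intro poisson_kernel_bounds) auto
        also have "\<dots> \<le> ?w t" using 1 k by (simp add: indicator_def)
        finally show ?thesis .
      next
        case 2
        have "k ^ 6 / ((k ^ 6)\<^sup>2 + (0 - t)\<^sup>2) \<le> k ^ 6 / ((k ^ 5)\<^sup>2)" using k 2 by (intro far) auto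
        also have "\<dots> = 1 / k ^ 4" using k by (simp add: field_simps power_mult[symmetric] power_add[symmetric])
        also have "\<dots> \<le> ?w t" using 2(2) k by (simp add: indicator_def)
        finally show ?thesis .
      next
        case 3
        have "k ^ 6 / ((k ^ 6)\<^sup>2 + (0 - t)\<^sup>2) \<le> k ^ 6 / ((k ^ 3)\<^sup>2)" using k 3 by (intro far) auto
        also have "\<dots> = 1" using k by (simp add: power_mult[symmetric])
        also have "\<dots> \<le> ?w t" using k by (simp add: indicator_def)
        finally show ?thesis .
      qed
    qed (use k in auto)
    also have "\<dots> = 1 / k ^ 6 * measure M {-(k^5)<..k^5} + 1 / k ^ 4 * measure M {-(k^3)<..k^3} + 1"
      by (subst Bochner_Integration.integral_add Bochner_Integration.integral_mult_right_zero
          | intro Bochner_Integration.integrable_add integrable_mult_right integrable_real_indicator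
          | simp add: emeasure_eq_measure prob_space[unfolded borel_UNIV])+
    also have "\<dots> \<le> 1 / k ^ 6 * (K * k ^ 5) + 1 / k ^ 4 * (K * k ^ 3) + 1 / k"
      using k kd by (intro add_mono mult_left_mono meas) auto
    also have "\<dots> = (2 * K + 1) / k" using k by (simp add: field_simps power_add[symmetric] eval_nat_numeral)
    finally show ?case .
  qed
  then show ?thesis by (intro that[of "2 * K + 1"]) (auto simp: K_def)
qed

text \<open>The denominator \<open>\<i> * y - z\<close> has real part \<epsilon>. This bounds the
  integrand by \<open>1 / \<epsilon>\<close>, so that \<open>Re\<close> passes under the integral,
  and it turns the real part of the reciprocal into the kernel.\<close>

lemma Re_stieltjes_transform:
  assumes "real_distribution M" "\<epsilon> > 0"
  shows "Re (stieltjes_transform (distr M borel (\<lambda>y. \<i> * of_real y)) (\<i> * of_real x - of_real \<epsilon>))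
      = poisson_integral M \<epsilon> x"
proof -
  interpret real_distribution M by fact
  have [measurable]: "(\<lambda>y. \<i> * complex_of_real y) \<in> borel_measurable M" by measurable
  let ?f = "\<lambda>y. 1 / (\<i> * complex_of_real y - (\<i> * of_real x - of_real \<epsilon>))"
  have norm: "norm (?f y) \<le> 1 / \<epsilon>" for y
  proof -
    have "\<epsilon> = Re (\<i> * complex_of_real y - (\<i> * of_real x - of_real \<epsilon>))" by simp
    also have "\<dots> \<le> norm (\<i> * complex_of_real y - (\<i> * of_real x - of_real \<epsilon>))" by (rule complex_Re_le_cmod)
    finally show ?thesis using assms(2) unfolding norm_divide norm_one
      by (intro divide_left_mono mult_pos_pos) auto
  qed
  have "stieltjes_transform (distr M borel (\<lambda>y. \<i> * of_real y)) (\<i> * of_real x - of_real \<epsilon>) = (\<integral>y. ?f y \<partial>M)"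
    unfolding stieltjes_transform_def by (subst integral_distr) auto
  also have "Re \<dots> = (\<integral>y. Re (?f y) \<partial>M)"
    using norm by (intro integral_Re[symmetric] integrable_const_bound[where B = "1 / \<epsilon>"]) auto
  also have "(\<lambda>y. Re (?f y)) = (\<lambda>y. \<epsilon> / (\<epsilon>\<^sup>2 + (x - y)\<^sup>2))"
    by (simp add: fun_eq_iff Re_divide power2_commute)
  finally show ?thesis by (simp add: poisson_integral_def)
qed

subsection \<open>The cubic equation\<close>

text \<open>Over the complex numbers \<open>cmod (poly p w)\<close> is the product of the distances
  from \<open>w\<close> to the roots, each at least the distance to the nearest root.\<close>

lemma monic_poly_root_near:
  fixes p :: "complex poly"
  assumes "lead_coeff p = 1" "degree p > 0"
  obtains r where "poly p r = 0" "cmod (w - r) ^ degree p \<le> cmod (poly p w)"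
proof -
  obtain A where A: "size A = degree p" "p = Polynomial.smult (lead_coeff p) (\<Prod>x\<in>#A. [:-x, 1:])"
    using alg_closed_imp_factorization[of p] assms(2) by (metis degree_0 less_irrefl)
  have p: "poly p y = (\<Prod>x\<in>#A. y - x)" for y
    by (subst A(2)) (simp add: assms poly_prod_mset image_mset.compositionality o_def)
  have "finite (set_mset A)" "set_mset A \<noteq> {}" using A(1) assms(2) by auto
  then obtain r where r: "r \<in># A" "\<forall>x\<in>#A. cmod (w - r) \<le> cmod (w - x)"
    using arg_min_if_finite(1)[of "set_mset A" "\<lambda>x. cmod (w - x)"]
      arg_min_least[of "set_mset A" _ "\<lambda>x. cmod (w - x)"] by blast
  have *: "cmod (w - r) ^ size B \<le> cmod (\<Prod>x\<in>#B. w - x)" if "\<forall>x\<in>#B. cmod (w - r) \<le> cmod (w - x)" for B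
    using that by (induction B) (auto simp: norm_mult intro!: mult_mono)
  have "cmod (w - r) ^ degree p \<le> cmod (poly p w)" using *[OF r(2)] by (simp add: p A(1))
  moreover have "poly p r = 0" using r(1) by (auto simp: p)
  ultimately show ?thesis using that by blast
qed

text \<open>This replaces continuity of roots: near a root of a limiting polynomial, roots of the
  approximating ones can be selected that converge to it, whatever its multiplicity.\<close>

lemma monic_poly_root_tendsto:
  fixes P :: "'a \<Rightarrow> complex poly"
  assumes "\<And>x. lead_coeff (P x) = 1" "\<And>x. degree (P x) = n" "n > 0"
    and "((\<lambda>x. poly (P x) w) \<longlongrightarrow> 0) F"
  obtains r where "\<And>x. poly (P x) (r x) = 0" "(r \<longlongrightarrow> w) F"
proof -
  have "\<exists>r. poly (P x) r = 0 \<and> cmod (w - r) ^ n \<le> cmod (poly (P x) w)" for x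
    using monic_poly_root_near[of "P x" w] assms(1-3) by metis
  then obtain r where r: "\<And>x. poly (P x) (r x) = 0" "\<And>x. cmod (w - r x) ^ n \<le> cmod (poly (P x) w)"
    by metis
  have "((\<lambda>x. root n (cmod (poly (P x) w))) \<longlongrightarrow> root n (cmod 0)) F"
    by (intro tendsto_intros assms)
  then have "((\<lambda>x. root n (cmod (poly (P x) w))) \<longlongrightarrow> 0) F" by simp
  moreover have "norm (r x - w) \<le> root n (cmod (poly (P x) w))" for x
    using real_root_le_mono[OF assms(3) r(2)[of x]] assms(3)
    by (simp add: real_root_power_cancel norm_minus_commute)
  ultimately have "((\<lambda>x. r x - w) \<longlongrightarrow> 0) F"
    by (intro Lim_null_comparison[of "\<lambda>x. r x - w"] always_eventually) auto
  then show ?thesis using that[of r] r(1) by (simp add: LIM_zero_iff)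
qed

section \<open>Reduction of the equation to a monic cubic\<close>

definition stieltjes_cubic :: "real \<Rightarrow> complex \<Rightarrow> complex poly" where
  "stieltjes_cubic c z =
     [: 1 / (of_real (c\<^sup>2) * z), of_real (1 / c\<^sup>2), of_real (1 - 2 / c) / z, 1 :]"

lemma monic_stieltjes_cubic:
  "lead_coeff (stieltjes_cubic c z) = 1" "degree (stieltjes_cubic c z) = 3"
  by (simp_all add: stieltjes_cubic_def)

lemma poly_stieltjes_cubic:
  "poly (stieltjes_cubic c z) m =
     m ^ 3 + of_real (1 - 2 / c) / z * m\<^sup>2 + of_real (1 / c\<^sup>2) * m + 1 / (of_real (c\<^sup>2) * z)"
  by (simp add: stieltjes_cubic_def algebra_simps power2_eq_square power3_eq_cube)

text \<open>For \<open>Re m > 0\<close> the three denominators have positive real part, so clearing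
  them loses nothing.\<close>

lemma stieltjes_equation_iff_poly:
  assumes "c > 0" "Re m > 0"
  shows "stieltjes_equation c z m \<longleftrightarrow>
    of_real (c\<^sup>2) * z * m ^ 3 + of_real (c\<^sup>2 - 2 * c) * m\<^sup>2 + z * m + 1 = 0"
proof -
  have nz: "m \<noteq> 0" "\<i> + of_real c * m \<noteq> 0" "- \<i> + of_real c * m \<noteq> 0"
    using assms by (auto simp: complex_eq_iff)
  define D where "D = (\<i> + of_real c * m) * (- \<i> + of_real c * m)"
  have D: "D \<noteq> 0" using nz by (simp add: D_def)
  have D_eq: "D = of_real (c\<^sup>2) * m\<^sup>2 + 1"
    by (simp add: D_def algebra_simps power2_eq_square)
  have "1 / (\<i> + of_real c * m) + 1 / (- \<i> + of_real c * m) = (2 * of_real c * m) / D"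
    unfolding D_def using nz by (subst add_frac_eq) simp_all
  then have "stieltjes_equation c z m \<longleftrightarrow> 1 / m = (2 * of_real c * m - z * D) / D"
    unfolding stieltjes_equation_def add.assoc using D by (simp add: diff_divide_distrib)
  also have "\<dots> \<longleftrightarrow> D = (2 * of_real c * m - z * D) * m"
    using nz(1) D by (simp add: frac_eq_eq)
  also have "\<dots> \<longleftrightarrow> D - (2 * of_real c * m - z * D) * m = 0" by simp
  also have "D - (2 * of_real c * m - z * D) * m =
      of_real (c\<^sup>2) * z * m ^ 3 + of_real (c\<^sup>2 - 2 * c) * m\<^sup>2 + z * m + 1"
    unfolding D_eq by (simp add: algebra_simps power2_eq_square power3_eq_cube)
  finally show ?thesis .
qed

lemma stieltjes_equation_iff_cubic:
  assumes "c > 0" "Re m > 0" "z \<noteq> 0"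
  shows "stieltjes_equation c z m \<longleftrightarrow> poly (stieltjes_cubic c z) m = 0"
proof -
  have "of_real (c\<^sup>2) * z * m ^ 3 + of_real (c\<^sup>2 - 2 * c) * m\<^sup>2 + z * m + 1
      = of_real (c\<^sup>2) * z * poly (stieltjes_cubic c z) m"
    using assms by (simp add: poly_stieltjes_cubic field_simps power2_eq_square)
  then show ?thesis using assms by (simp add: stieltjes_equation_iff_poly)
qed

text \<open>A root with \<open>cmod m > 1\<close> has all lower terms bounded by a constant times
  \<open>(cmod m)\<^sup>2\<close>, which \<open>(cmod m) ^ 3\<close> cannot exceed for large
  \<open>m\<close>. Uniformity in \<open>cmod z \<ge> \<delta>\<close> later provides the domination
  away from 0.\<close>

lemma stieltjes_cubic_root_bound:
  assumes "c > 0" "poly (stieltjes_cubic c z) m = 0" "cmod z \<ge> \<delta>" "\<delta> > 0"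
  shows "cmod m \<le> 1 + (\<bar>1 - 2 / c\<bar> + 1 / c\<^sup>2) / \<delta> + 1 / c\<^sup>2"
proof (rule ccontr)
  let ?A = "\<bar>1 - 2 / c\<bar>" and ?B = "1 / c\<^sup>2"
  assume "\<not> ?thesis"
  moreover have "(?A + ?B) / \<delta> \<ge> 0" "?B \<ge> 0" using assms by auto
  ultimately have m: "cmod m > 1" "cmod m > (?A + ?B) / \<delta> + ?B" by linarith+
  have z: "cmod z > 0" using assms(3,4) by linarith
  have "m ^ 3 = - (of_real (1 - 2 / c) / z * m\<^sup>2 + of_real (1 / c\<^sup>2) * m + 1 / (of_real (c\<^sup>2) * z))"
    using assms(2) unfolding poly_stieltjes_cubic by (simp only: eq_neg_iff_add_eq_0 add.assoc)
  then have "cmod m ^ 3 = cmod (of_real (1 - 2 / c) / z * m\<^sup>2 + of_real (1 / c\<^sup>2) * m + 1 / (of_real (c\<^sup>2) * z))"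
    by (metis norm_minus_cancel norm_power)
  also have "\<dots> \<le> cmod (of_real (1 - 2 / c) / z * m\<^sup>2) + cmod (of_real (1 / c\<^sup>2) * m) + cmod (1 / (of_real (c\<^sup>2) * z))"
    by (meson norm_add_leD norm_triangle_ineq order_trans add_right_mono)
  also have "\<dots> = ?A / cmod z * (cmod m)\<^sup>2 + ?B * cmod m + ?B / cmod z"
    by (simp only: norm_mult norm_divide norm_power norm_of_real norm_one) (simp add: abs_mult)
  also have "\<dots> \<le> ?A / \<delta> * (cmod m)\<^sup>2 + ?B * (cmod m)\<^sup>2 + ?B / \<delta> * (cmod m)\<^sup>2"
  proof (intro add_mono mult_mono)
    show "?A / cmod z \<le> ?A / \<delta>" using assms z by (intro divide_left_mono mult_pos_pos) auto
    have "?B / cmod z \<le> ?B / \<delta>" using assms z by (intro divide_left_mono mult_pos_pos) auto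
    also have "\<dots> \<le> ?B / \<delta> * (cmod m)\<^sup>2"
      using mult_left_mono[of 1 "(cmod m)\<^sup>2" "?B / \<delta>"] m(1) assms by (simp add: one_le_power)
    finally show "?B / cmod z \<le> ?B / \<delta> * (cmod m)\<^sup>2" .
    show "cmod m \<le> (cmod m)\<^sup>2" using m(1) mult_left_mono[of 1 "cmod m" "cmod m"] by (simp add: power2_eq_square)
  qed (use assms in auto)
  also have "\<dots> = ((?A + ?B) / \<delta> + ?B) * (cmod m)\<^sup>2" by (simp add: algebra_simps add_divide_distrib)
  also have "\<dots> < cmod m * (cmod m)\<^sup>2" using m by (intro mult_strict_right_mono) auto
  finally show False by (simp add: power2_eq_square power3_eq_cube)
qed

text \<open>Near \<open>z = 0\<close> the leading coefficient of the cubic degenerates; its reciprocal polynomial, the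
  equation for \<open>1 / m\<close>, stays monic.\<close>

definition reciprocal_cubic :: "real \<Rightarrow> complex \<Rightarrow> complex poly" where
  "reciprocal_cubic c z = [: of_real (c\<^sup>2) * z, of_real (c\<^sup>2 - 2 * c), z, 1 :]"

lemma monic_reciprocal_cubic:
  "lead_coeff (reciprocal_cubic c z) = 1" "degree (reciprocal_cubic c z) = 3"
  by (simp_all add: reciprocal_cubic_def)

lemma poly_reciprocal_cubic:
  "poly (reciprocal_cubic c z) w = w ^ 3 + z * w\<^sup>2 + of_real (c\<^sup>2 - 2 * c) * w + of_real (c\<^sup>2) * z"
  by (simp add: reciprocal_cubic_def algebra_simps power2_eq_square power3_eq_cube)

lemma stieltjes_equation_iff_reciprocal:
  assumes "c > 0" "Re m > 0"
  shows "stieltjes_equation c z m \<longleftrightarrow> poly (reciprocal_cubic c z) (1 / m) = 0"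
proof -
  have m: "m \<noteq> 0" using assms by auto
  then have "of_real (c\<^sup>2) * z * m ^ 3 + of_real (c\<^sup>2 - 2 * c) * m\<^sup>2 + z * m + 1
    = m ^ 3 * poly (reciprocal_cubic c z) (1 / m)"
    by (simp add: poly_reciprocal_cubic field_simps power2_eq_square power3_eq_cube)
  then show ?thesis using assms m by (simp add: stieltjes_equation_iff_poly)
qed

section \<open>Cardano's formula on the imaginary axis\<close>

text \<open>On the imaginary axis the depressed cubic has real coefficients: with \<open>Q\<close> from Cardano's formula
  and \<open>R (\<i> x) = \<i> \<rho>\<close>, it becomes \<open>y\<^sup>3 - 3 Q y - 2 \<rho>\<close> in the shifted variable \<open>y\<close> of
  \<open>stieltjes_cubic_imag_axis\<close> below, and \<open>disc_d = Q\<^sup>3 - \<rho>\<^sup>2\<close>.\<close>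

definition cubic_rho :: "real \<Rightarrow> real \<Rightarrow> real" where
  "cubic_rho c x = cubic_r3 c / x ^ 3 - cubic_r1 c / x"

lemma cubic_r_eq:
  assumes "x \<noteq> 0"
  shows "cubic_r c x = \<i> * of_real (cubic_rho c x)"
proof -
  have "((\<lambda>\<epsilon>. cubic_R c (of_real (- \<epsilon>) + \<i> * of_real x)) \<longlongrightarrow>
      cubic_R c (of_real (- 0) + \<i> * of_real x)) (at_right 0)"
    unfolding cubic_R_def using assms by (intro tendsto_intros) auto
  then have "cubic_r c x = cubic_R c (\<i> * of_real x)"
    unfolding cubic_r_def by (intro tendsto_Lim) auto
  also have "\<dots> = \<i> * of_real (cubic_rho c x)"
    using assms unfolding cubic_R_def cubic_rho_def
    by (simp add: field_simps power3_eq_cube)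
  finally show ?thesis .
qed

text \<open>\<open>x ^ 4 * disc_d c x\<close> is a quadratic in \<open>x\<^sup>2\<close> with roots
  \<open>R_minus c\<close> and \<open>R_plus c\<close>, hence negative exactly between them.
  Truncating \<open>R_minus c\<close> at 0 is harmless because \<open>x\<^sup>2 > 0\<close>.\<close>

lemma support_set_iff:
  assumes "c > 0" "x \<noteq> 0"
  shows "x \<in> support_set c \<longleftrightarrow> disc_d c x < 0"
proof -
  \<comment> \<open>The discriminant collapses to a positive cube, which makes both roots
    real.\<close>
  have disc: "(disc_d2 c)\<^sup>2 - 4 * disc_d0 c * disc_d4 c = (4 * c + 1) ^ 3 / (27 * c ^ 6)\<^sup>2"
    using assms unfolding disc_d0_def disc_d2_def disc_d4_def
    by (simp add: divide_simps) (simp add: algebra_simps power_def)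
  define D where "D = sqrt ((disc_d2 c)\<^sup>2 - 4 * disc_d0 c * disc_d4 c)"
  have D: "D \<ge> 0" "D\<^sup>2 = (disc_d2 c)\<^sup>2 - 4 * disc_d0 c * disc_d4 c"
    using assms unfolding D_def disc by auto
  have d0: "disc_d0 c > 0" using assms by (simp add: disc_d0_def)
  have le: "R_minus c \<le> R_plus c"
    unfolding R_minus_def R_plus_def D_def[symmetric] using d0 D(1) by (intro divide_right_mono) auto
  have fact: "disc_d0 c * (t - R_minus c) * (t - R_plus c) = disc_d0 c * t\<^sup>2 - disc_d2 c * t + disc_d4 c" for t
  proof -
    have *: "R_minus c + R_plus c = disc_d2 c / disc_d0 c"
      unfolding R_minus_def R_plus_def D_def[symmetric] using d0 by (simp add: field_simps)
    have "R_minus c * R_plus c = ((disc_d2 c)\<^sup>2 - D\<^sup>2) / (4 * (disc_d0 c)\<^sup>2)"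
      unfolding R_minus_def R_plus_def D_def[symmetric] using d0 by (simp add: field_simps power2_eq_square)
    also have "\<dots> = disc_d4 c / disc_d0 c"
      unfolding D(2) using d0 by (simp add: field_simps power2_eq_square)
    finally have **: "R_minus c * R_plus c = disc_d4 c / disc_d0 c" .
    have "disc_d0 c * (t - R_minus c) * (t - R_plus c)
       = disc_d0 c * t\<^sup>2 - disc_d0 c * (R_minus c + R_plus c) * t + disc_d0 c * (R_minus c * R_plus c)"
      by (simp add: algebra_simps power2_eq_square)
    then show ?thesis unfolding * ** using d0 by simp
  qed
  have "disc_d c x = disc_d0 c * (x\<^sup>2 - R_minus c) * (x\<^sup>2 - R_plus c) / x ^ 4"
    unfolding fact disc_d_def using assms by (simp add: field_simps power2_eq_square power4_eq_xxxx)
  moreover have "x ^ 4 > 0" using assms by (simp add: zero_less_power_eq)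
  ultimately have "disc_d c x < 0 \<longleftrightarrow> disc_d0 c * (x\<^sup>2 - R_minus c) * (x\<^sup>2 - R_plus c) < 0"
    by (simp add: divide_less_0_iff)
  also have "\<dots> \<longleftrightarrow> (x\<^sup>2 - R_minus c) * (x\<^sup>2 - R_plus c) < 0"
    using d0 by (simp add: mult.assoc mult_less_0_iff)
  also have "\<dots> \<longleftrightarrow> R_minus c < x\<^sup>2 \<and> x\<^sup>2 < R_plus c"
    using le by (auto simp: mult_less_0_iff)
  also have "\<dots> \<longleftrightarrow> L_edge c < \<bar>x\<bar> \<and> \<bar>x\<bar> < U_edge c"
  proof -
    have "L_edge c < \<bar>x\<bar> \<longleftrightarrow> R_minus c * indicator {0<..} (R_minus c) < x\<^sup>2"
      unfolding L_edge_def real_sqrt_abs[symmetric] by (simp only: real_sqrt_less_iff)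
    also have "\<dots> \<longleftrightarrow> R_minus c < x\<^sup>2"
      using assms order.strict_trans1[of "R_minus c" 0 "x\<^sup>2"] by (auto simp: indicator_def)
    finally show ?thesis
      unfolding U_edge_def real_sqrt_abs[symmetric] by (simp only: real_sqrt_less_iff)
  qed
  also have "\<dots> \<longleftrightarrow> x \<in> support_set c"
  proof -
    have "L_edge c \<ge> 0" by (auto simp: L_edge_def indicator_def)
    then show ?thesis unfolding support_set_def by auto
  qed
  finally show ?thesis by simp
qed

text \<open>Cardano's \<open>(3 * a1 - a2\<^sup>2) / 9\<close> at \<open>z = \<i> * x\<close>, with
  \<open>a2\<close> and \<open>a1\<close> the coefficients of \<open>m\<^sup>2\<close> and
  \<open>m\<close>; since \<open>a2\<close> is imaginary there, the difference becomes a
  sum.\<close>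

definition cubic_Q :: "real \<Rightarrow> real \<Rightarrow> real" where
  "cubic_Q c x = (3 / c\<^sup>2 + (1 - 2 / c)\<^sup>2 / x\<^sup>2) / 9"

lemma cubic_Q_pos: "c > 0 \<Longrightarrow> cubic_Q c x > 0"
  unfolding cubic_Q_def by (intro divide_pos_pos add_pos_nonneg) auto

text \<open>In terms of \<open>1 / c\<close> and \<open>1 / x\<close> the identities below become
  polynomial identities, which normalisation alone settles.\<close>

lemma cubic_coeffs_inverse:
  fixes c :: real
  assumes "c > 0"
  shows "disc_d0 c = (1 / c) ^ 6 / 27" "disc_d2 c = (2 * (1 / c) ^ 4 + 10 * (1 / c) ^ 5 - (1 / c) ^ 6) / 27"
    "disc_d4 c = (1 - 2 * (1 / c)) ^ 3 * (1 / c)\<^sup>2 / 27"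
    "cubic_r1 c = - (((1 / c)\<^sup>2 + (1 / c) ^ 3) / 3)" "cubic_r3 c = - ((1 - 2 * (1 / c)) ^ 3) / 27"
proof -
  show "disc_d0 c = (1 / c) ^ 6 / 27" "disc_d4 c = (1 - 2 * (1 / c)) ^ 3 * (1 / c)\<^sup>2 / 27"
    by (simp_all add: disc_d0_def disc_d4_def power_divide)
  show "disc_d2 c = (2 * (1 / c) ^ 4 + 10 * (1 / c) ^ 5 - (1 / c) ^ 6) / 27"
    "cubic_r1 c = - (((1 / c)\<^sup>2 + (1 / c) ^ 3) / 3)"
    using assms by (simp_all add: disc_d2_def cubic_r1_def field_simps power_def)
  have "1 - 2 * (1 / c) = (c - 2) / c" using assms by (simp add: field_simps)
  then show "cubic_r3 c = - ((1 - 2 * (1 / c)) ^ 3) / 27"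
    by (simp add: cubic_r3_def power_divide)
qed

lemma disc_d_eq:
  assumes "c > 0"
  shows "disc_d c x = cubic_Q c x ^ 3 - (cubic_rho c x)\<^sup>2"
proof -
  define g t where "g = 1 / c" and "t = 1 / x"
  have Q: "cubic_Q c x = (3 * g\<^sup>2 + (1 - 2 * g)\<^sup>2 * t\<^sup>2) / 9"
    by (simp add: cubic_Q_def g_def t_def power_divide)
  have r: "cubic_rho c x = - ((1 - 2 * g) ^ 3) / 27 * t ^ 3 + (g\<^sup>2 + g ^ 3) / 3 * t"
    unfolding cubic_rho_def cubic_coeffs_inverse[OF assms] by (simp add: g_def t_def power_divide)
  have d: "disc_d c x = g ^ 6 / 27 - (2 * g ^ 4 + 10 * g ^ 5 - g ^ 6) / 27 * t\<^sup>2
      + (1 - 2 * g) ^ 3 * g\<^sup>2 / 27 * t ^ 4"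
    unfolding disc_d_def cubic_coeffs_inverse[OF assms] by (simp add: g_def t_def power_divide)
  show ?thesis unfolding Q r d by (simp add: field_simps eval_nat_numeral)
qed

text \<open>The factor \<open>- \<i>\<close> makes the coefficients real and the shift removes the
  quadratic term. As the shift is real, \<open>Re m = Im y\<close>: the sought real parts are
  imaginary parts of roots of a real cubic.\<close>

lemma stieltjes_cubic_imag_axis:
  assumes "c > 0" "x \<noteq> 0"
  shows "poly (stieltjes_cubic c (\<i> * of_real x)) (- \<i> * (y - of_real ((1 - 2 / c) / (3 * x))))
      = \<i> * (y ^ 3 - 3 * of_real (cubic_Q c x) * y - 2 * of_real (cubic_rho c x))"
proof -
  define g t where "g = complex_of_real (1 / c)" and "t = complex_of_real (1 / x)"
  have Q: "of_real (cubic_Q c x) = (3 * g\<^sup>2 + (1 - 2 * g)\<^sup>2 * t\<^sup>2) / 9"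
    by (simp add: cubic_Q_def g_def t_def power_divide)
  have r: "of_real (cubic_rho c x) = - ((1 - 2 * g) ^ 3) / 27 * t ^ 3 + (g\<^sup>2 + g ^ 3) / 3 * t"
    unfolding cubic_rho_def cubic_coeffs_inverse[OF assms(1)] by (simp add: g_def t_def power_divide)
  have a: "of_real ((1 - 2 / c) / (3 * x)) = (1 - 2 * g) * t / 3"
    by (simp add: g_def t_def)
  have b: "of_real (1 - 2 / c) / (\<i> * of_real x) = - \<i> * (1 - 2 * g) * t"
    "of_real (1 / c\<^sup>2) = g\<^sup>2" "1 / (of_real (c\<^sup>2) * (\<i> * of_real x)) = - \<i> * g\<^sup>2 * t"
    using assms by (simp_all add: g_def t_def power_divide divide_simps)
  have i: "(- \<i> * w) ^ 3 = \<i> * w ^ 3" "(- \<i> * w)\<^sup>2 = - (w\<^sup>2)" for w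
    by (simp_all add: power2_eq_square power3_eq_cube algebra_simps)
  show ?thesis unfolding poly_stieltjes_cubic Q r a b
    unfolding i by (simp add: field_simps eval_nat_numeral)
qed

text \<open>Where \<open>disc_d c x \<ge> 0\<close>, truncating the radicand at 0 makes the two cube
  roots cancel. Thus the indicator can be absorbed into a formula that is continuous across the
  edges too.\<close>

lemma continuous_limit_density: "c > 0 \<Longrightarrow> continuous_on (- {0}) (limit_density c)"
proof -
  assume c: "c > 0"
  have eq: "limit_density c x = sqrt 3 / (2 * pi) *
      (root 3 (\<bar>cubic_rho c x\<bar> + sqrt (max 0 (- disc_d c x))) - root 3 (\<bar>cubic_rho c x\<bar> - sqrt (max 0 (- disc_d c x))))"
    if "x \<in> - {0}" for x
    using that support_set_iff[OF c, of x]
    by (cases "disc_d c x < 0")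
       (simp_all add: limit_density_def V_plus_def V_minus_def cubic_r_eq norm_mult max_def indicator_def)
  have cont: "continuous_on (- {0}) (\<lambda>x. sqrt 3 / (2 * pi) *
      (root 3 (\<bar>cubic_rho c x\<bar> + sqrt (max 0 (- disc_d c x))) - root 3 (\<bar>cubic_rho c x\<bar> - sqrt (max 0 (- disc_d c x)))))"
    unfolding cubic_rho_def disc_d_def by (intro continuous_intros) auto
  show ?thesis by (rule continuous_on_eq[OF cont]) (simp only: eq)
qed

section \<open>Roots of real depressed cubics\<close>

lemma complex_cube: "Complex p q ^ 3 = Complex (p ^ 3 - 3 * p * q\<^sup>2) (3 * p\<^sup>2 * q - q ^ 3)"
  by (simp add: complex_eq_iff power2_eq_square power3_eq_cube algebra_simps)

text \<open>For a nonreal root with real part \<open>p\<close>, the imaginary part of the equation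
  gives \<open>p\<^sup>2 > Q\<close>; eliminating the imaginary part of the root then makes
  \<open>\<rho>\<^sup>2 - Q ^ 3\<close> a positive product.\<close>

lemma depressed_cubic_real_roots:
  fixes Q \<rho> :: real and y :: complex
  assumes "y ^ 3 - 3 * of_real Q * y - 2 * of_real \<rho> = 0" "Q > 0" "\<rho>\<^sup>2 \<le> Q ^ 3"
  shows "Im y = 0"
proof (rule ccontr)
  assume q: "Im y \<noteq> 0"
  define p q where "p = Re y" and "q = Im y"
  have y: "y = Complex p q" by (simp add: p_def q_def)
  have re: "p ^ 3 - 3 * p * q\<^sup>2 - 3 * Q * p - 2 * \<rho> = 0"
    and "3 * p\<^sup>2 * q - q ^ 3 - 3 * Q * q = 0"
    using assms(1) unfolding y complex_cube by (simp_all add: complex_eq_iff)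
  then have "q * (3 * p\<^sup>2 - q\<^sup>2 - 3 * Q) = 0" by (simp add: algebra_simps power2_eq_square power3_eq_cube)
  then have q2: "q\<^sup>2 = 3 * p\<^sup>2 - 3 * Q" using q by (simp add: q_def)
  then have pQ: "p\<^sup>2 > Q" using q by (metis q_def diff_gt_0_iff_gt mult_less_cancel_left_pos zero_less_numeral zero_less_power2)
  have \<rho>: "\<rho> = - (4 * p ^ 3 - 3 * Q * p)"
    using re unfolding q2 by (simp add: algebra_simps power2_eq_square power3_eq_cube)
  have "\<rho>\<^sup>2 - Q ^ 3 = (p\<^sup>2 - Q) * (4 * p\<^sup>2 - Q)\<^sup>2"
    unfolding \<rho> by (simp add: algebra_simps power2_eq_square power3_eq_cube)
  moreover have "(p\<^sup>2 - Q) * (4 * p\<^sup>2 - Q)\<^sup>2 > 0"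
    using pQ assms(2) by (intro mult_pos_pos) auto
  ultimately show False using assms(3) by simp
qed

text \<open>Cardano: from \<open>u * v = Q\<close> and
  \<open>u ^ 3 + v ^ 3 = 2 * \<bar>\<rho>\<bar>\<close> the real root is \<plusminus>(u + v), and
  the other two arise by cube roots of unity. Separating off the sign of \<rho> keeps
  \<open>u \<ge> v\<close>, as in \<open>V_plus\<close> and \<open>V_minus\<close>. Since
  \<open>root 3\<close> is odd, \<open>\<bar>\<rho>\<bar> - D\<close> may have any sign.\<close>

lemma depressed_cubic_nonreal_root:
  fixes Q \<rho> D :: real
  assumes "D \<ge> 0" "D\<^sup>2 = \<rho>\<^sup>2 - Q ^ 3"
  defines "u \<equiv> root 3 (\<bar>\<rho>\<bar> + D)" and "v \<equiv> root 3 (\<bar>\<rho>\<bar> - D)"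
  obtains y where "y ^ 3 - 3 * of_real Q * y - 2 * of_real \<rho> = 0" "Im y = sqrt 3 / 2 * (u - v)"
proof
  \<comment> \<open>Unlike \<open>sgn\<close>, this is 1 at \<open>\<rho> = 0\<close>, so that
    \<open>\<sigma>\<^sup>2 = 1\<close> always.\<close>
  define \<sigma> where "\<sigma> = (if \<rho> < 0 then -1 else 1 :: real)"
  define p where "p = - \<sigma> * (u + v) / 2"
  define q where "q = sqrt 3 / 2 * (u - v)"
  have \<sigma>: "\<sigma>\<^sup>2 = 1" "\<sigma> * \<bar>\<rho>\<bar> = \<rho>" by (auto simp: \<sigma>_def)
  have uv3: "u ^ 3 + v ^ 3 = 2 * \<bar>\<rho>\<bar>" by (simp add: u_def v_def odd_real_root_pow)
  have "(\<bar>\<rho>\<bar> + D) * (\<bar>\<rho>\<bar> - D) = Q ^ 3"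
    using assms(2) by (simp add: algebra_simps power2_eq_square abs_mult_self_eq)
  then have uv: "u * v = Q" by (simp add: u_def v_def real_root_mult[symmetric] odd_real_root_power_cancel)
  have q2: "q\<^sup>2 = 3 / 4 * (u - v)\<^sup>2" by (simp add: q_def power_mult_distrib power_divide)
  have p2: "p\<^sup>2 = (u + v)\<^sup>2 / 4" using \<sigma>(1) by (simp add: p_def power_mult_distrib power_divide)
  have im: "3 * p\<^sup>2 - q\<^sup>2 - 3 * Q = 0"
    unfolding p2 q2 uv[symmetric] by (simp add: field_simps power2_eq_square)
  have "p ^ 3 - 3 * p * q\<^sup>2 - 3 * Q * p = p * (p\<^sup>2 - 3 * q\<^sup>2 - 3 * Q)"
    by (simp add: algebra_simps power2_eq_square power3_eq_cube)
  also have "\<dots> = \<sigma> * (u ^ 3 + v ^ 3)"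
    unfolding p2 q2 uv[symmetric] unfolding p_def by (simp add: field_simps power2_eq_square power3_eq_cube)
  also have "\<dots> = 2 * \<rho>" unfolding uv3 using \<sigma>(2) by simp
  finally have re: "p ^ 3 - 3 * p * q\<^sup>2 - 3 * Q * p - 2 * \<rho> = 0" by simp
  have "3 * p\<^sup>2 * q - q ^ 3 - 3 * Q * q = q * (3 * p\<^sup>2 - q\<^sup>2 - 3 * Q)"
    by (simp add: algebra_simps power2_eq_square power3_eq_cube)
  then have "3 * p\<^sup>2 * q - q ^ 3 - 3 * Q * q = 0" unfolding im by simp
  with re show "Complex p q ^ 3 - 3 * of_real Q * Complex p q - 2 * of_real \<rho> = 0"
    unfolding complex_cube by (simp add: complex_eq_iff)
  show "Im (Complex p q) = sqrt 3 / 2 * (u - v)" by (simp add: q_def)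
qed

subsection \<open>Boundary values of the Stieltjes transform\<close>

text \<open>The boundary analysis is separated from measure theory: all it knows of \<open>s\<close>
  is that it is the unique solution in the right half-plane.\<close>

locale stieltjes_solution =
  fixes c :: real and s :: "complex \<Rightarrow> complex"
  assumes c_pos: "c > 0"
    and solution: "\<And>z. Re z < 0 \<Longrightarrow> {m. Re m > 0 \<and> stieltjes_equation c z m} = {s z}"
begin

lemma Re_s_pos: "Re z < 0 \<Longrightarrow> Re (s z) > 0"
  and s_equation: "Re z < 0 \<Longrightarrow> stieltjes_equation c z (s z)"
  and s_unique: "Re z < 0 \<Longrightarrow> Re m > 0 \<Longrightarrow> stieltjes_equation c z m \<Longrightarrow> m = s z"
  using solution[of z] by auto

lemma s_cubic: "Re z < 0 \<Longrightarrow> poly (stieltjes_cubic c z) (s z) = 0"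
  using stieltjes_equation_iff_cubic[OF c_pos Re_s_pos, of z z] s_equation[of z] by fastforce

lemma s_bounded:
  assumes "\<delta> > 0"
  obtains B where "\<And>z. Re z < 0 \<Longrightarrow> cmod z \<ge> \<delta> \<Longrightarrow> cmod (s z) \<le> B"
  using stieltjes_cubic_root_bound[OF c_pos s_cubic _ assms] by blast

lemma cubic_tendsto:
  assumes "x \<noteq> 0"
  shows "((\<lambda>\<epsilon>. poly (stieltjes_cubic c (\<i> * of_real x - of_real \<epsilon>)) m)
     \<longlongrightarrow> poly (stieltjes_cubic c (\<i> * of_real x)) m) (at_right 0)"
proof -
  have "((\<lambda>\<epsilon>. poly (stieltjes_cubic c (\<i> * of_real x - of_real \<epsilon>)) m)
     \<longlongrightarrow> poly (stieltjes_cubic c (\<i> * of_real x - of_real 0)) m) (at_right 0)"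
    unfolding poly_stieltjes_cubic using assms c_pos by (intro tendsto_intros) auto
  then show ?thesis by simp
qed

lemma s_boundary_limit_inside:
  assumes "x \<noteq> 0" "x \<in> support_set c"
  shows "((\<lambda>\<epsilon>. Re (s (\<i> * of_real x - of_real \<epsilon>))) \<longlongrightarrow> pi * limit_density c x) (at_right 0)"
proof -
  have d: "disc_d c x < 0" using support_set_iff[OF c_pos assms(1)] assms(2) by simp
  define D where "D = sqrt (- disc_d c x)"
  have D: "D > 0" "D\<^sup>2 = (cubic_rho c x)\<^sup>2 - cubic_Q c x ^ 3"
    using d disc_d_eq[OF c_pos, of x] by (auto simp: D_def)
  obtain y where y: "y ^ 3 - 3 * of_real (cubic_Q c x) * y - 2 * of_real (cubic_rho c x) = 0"
    "Im y = sqrt 3 / 2 * (root 3 (\<bar>cubic_rho c x\<bar> + D) - root 3 (\<bar>cubic_rho c x\<bar> - D))"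
    using depressed_cubic_nonreal_root[OF less_imp_le[OF D(1)] D(2)] by blast
  define m where "m = - \<i> * (y - of_real ((1 - 2 / c) / (3 * x)))"
  have m0: "poly (stieltjes_cubic c (\<i> * of_real x)) m = 0"
    unfolding m_def stieltjes_cubic_imag_axis[OF c_pos assms(1)] y(1) by simp
  have Re_m: "Re m = Im y" by (simp add: m_def)
  have "Im y = pi * limit_density c x"
    unfolding y(2) D_def using assms
    by (simp add: limit_density_def V_plus_def V_minus_def cubic_r_eq norm_mult)
  then have Re_m': "Re m = pi * limit_density c x" using Re_m by simp
  have "root 3 (\<bar>cubic_rho c x\<bar> - D) < root 3 (\<bar>cubic_rho c x\<bar> + D)" using D(1) by simp
  then have pos: "Re m > 0" unfolding Re_m y(2) by simp
  obtain r where r: "\<And>\<epsilon>. poly (stieltjes_cubic c (\<i> * of_real x - of_real \<epsilon>)) (r \<epsilon>) = 0"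
    "(r \<longlongrightarrow> m) (at_right (0::real))"
    using monic_poly_root_tendsto[OF monic_stieltjes_cubic _ cubic_tendsto[OF assms(1), of m, unfolded m0]]
    by auto
  have "((\<lambda>\<epsilon>. Re (r \<epsilon>)) \<longlongrightarrow> Re m) (at_right 0)" using r(2) by (rule tendsto_Re)
  \<comment> \<open>Once the selected root has positive real part, uniqueness identifies it with
    \<open>s\<close>.\<close>
  moreover from order_tendstoD(1)[OF this pos]
  have "eventually (\<lambda>\<epsilon>. Re (r \<epsilon>) > 0 \<and> \<epsilon> > 0) (at_right 0)"
    using eventually_at_right_less by (rule eventually_conj)
  then have "eventually (\<lambda>\<epsilon>. Re (r \<epsilon>) = Re (s (\<i> * of_real x - of_real \<epsilon>))) (at_right 0)"
  proof eventually_elim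
    case (elim \<epsilon>)
    then have "stieltjes_equation c (\<i> * of_real x - of_real \<epsilon>) (r \<epsilon>)"
      using r(1)[of \<epsilon>] assms(1) by (subst stieltjes_equation_iff_cubic[OF c_pos]) (auto simp: complex_eq_iff)
    then show ?case using s_unique[of "\<i> * of_real x - of_real \<epsilon>" "r \<epsilon>"] elim by simp
  qed
  ultimately show ?thesis unfolding Re_m' by (simp cong: tendsto_cong)
qed

text \<open>Convergence of \<open>s\<close> itself is not claimed. Since \<open>s\<close> stays
  bounded, its values nearly solve the cubic at \<open>\<i> * x\<close>, hence lie near one of its
  roots, and these are all imaginary; edges of the support are included.\<close>

lemma s_boundary_limit_outside:
  assumes "x \<noteq> 0" "x \<notin> support_set c"
  shows "((\<lambda>\<epsilon>. Re (s (\<i> * of_real x - of_real \<epsilon>))) \<longlongrightarrow> 0) (at_right 0)"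
proof -
  let ?z = "\<lambda>\<epsilon>::real. \<i> * of_real x - of_real \<epsilon>"
  have d: "(cubic_rho c x)\<^sup>2 \<le> cubic_Q c x ^ 3"
    using support_set_iff[OF c_pos assms(1)] assms(2) disc_d_eq[OF c_pos, of x] by simp
  have imag: "Re m = 0" if "poly (stieltjes_cubic c (\<i> * of_real x)) m = 0" for m
  proof -
    define y where "y = \<i> * m + of_real ((1 - 2 / c) / (3 * x))"
    have "m = - \<i> * (y - of_real ((1 - 2 / c) / (3 * x)))" by (simp add: y_def)
    then have "y ^ 3 - 3 * of_real (cubic_Q c x) * y - 2 * of_real (cubic_rho c x) = 0"
      using that stieltjes_cubic_imag_axis[OF c_pos assms(1), of y] by simp
    from depressed_cubic_real_roots[OF this cubic_Q_pos[OF c_pos] d] show ?thesis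
      by (simp add: y_def)
  qed
  obtain B where B: "\<And>z. Re z < 0 \<Longrightarrow> cmod z \<ge> \<bar>x\<bar> \<Longrightarrow> cmod (s z) \<le> B"
    using s_bounded[of "\<bar>x\<bar>"] assms(1) by auto
  have z: "Re (?z \<epsilon>) < 0" "cmod (?z \<epsilon>) \<ge> \<bar>x\<bar>" "?z \<epsilon> \<noteq> 0" if "\<epsilon> > 0" for \<epsilon>
    using that abs_Im_le_cmod[of "?z \<epsilon>"] assms(1) by (auto simp: complex_eq_iff)
  \<comment> \<open>The cubics at \<open>\<i> * x\<close> and \<open>?z \<epsilon>\<close> differ
    only in the terms with \<open>1 / z\<close>, so at \<open>s (?z \<epsilon>)\<close> their
    difference has a factor tending to 0; \<open>g\<close> bounds it.\<close>
  define g where "g \<epsilon> = cmod (1 / (\<i> * of_real x) - 1 / ?z \<epsilon>) * (\<bar>1 - 2 / c\<bar> * B\<^sup>2 + 1 / c\<^sup>2)" for \<epsilon>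
  have "(g \<longlongrightarrow> cmod (1 / (\<i> * of_real x) - 1 / ?z 0) * (\<bar>1 - 2 / c\<bar> * B\<^sup>2 + 1 / c\<^sup>2)) (at_right 0)"
    unfolding g_def using assms(1) by (intro tendsto_intros) auto
  then have "(g \<longlongrightarrow> 0) (at_right 0)" by simp
  then have "((\<lambda>\<epsilon>. root 3 (g \<epsilon>)) \<longlongrightarrow> root 3 0) (at_right 0)" by (rule tendsto_real_root)
  then have "((\<lambda>\<epsilon>. root 3 (g \<epsilon>)) \<longlongrightarrow> 0) (at_right 0)" by simp
  moreover have "eventually (\<lambda>\<epsilon>. norm (Re (s (?z \<epsilon>))) \<le> root 3 (g \<epsilon>)) (at_right 0)"
    using eventually_at_right_less[of "0::real"]
  proof eventually_elim
    case (elim \<epsilon>)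
    let ?m = "s (?z \<epsilon>)"
    have diff: "(m ^ 3 + A / z * m\<^sup>2 + B' * m + 1 / (C * z)) - (m ^ 3 + A / z' * m\<^sup>2 + B' * m + 1 / (C * z'))
        = (1 / z - 1 / z') * (A * m\<^sup>2 + 1 / C)" for A B' C z z' m :: complex
      by (simp add: divide_inverse algebra_simps)
    obtain r where r: "poly (stieltjes_cubic c (\<i> * of_real x)) r = 0"
      "cmod (?m - r) ^ 3 \<le> cmod (poly (stieltjes_cubic c (\<i> * of_real x)) ?m)"
      using monic_poly_root_near[OF monic_stieltjes_cubic(1)[of c "\<i> * of_real x"], of ?m]
      by (auto simp: monic_stieltjes_cubic(2))
    have "Re ?m = Re (?m - r)" using imag[OF r(1)] by simp
    then have "Re ?m \<le> cmod (?m - r)" by (metis complex_Re_le_cmod)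
    then have "Re ?m ^ 3 \<le> cmod (?m - r) ^ 3"
      using Re_s_pos[OF z(1)[OF elim]] by (intro power_mono) auto
    also note r(2)
    also have "poly (stieltjes_cubic c (\<i> * of_real x)) ?m
       = poly (stieltjes_cubic c (\<i> * of_real x)) ?m - poly (stieltjes_cubic c (?z \<epsilon>)) ?m"
      using s_cubic[OF z(1)[OF elim]] by simp
    also have "\<dots> = (1 / (\<i> * of_real x) - 1 / ?z \<epsilon>) * (of_real (1 - 2 / c) * ?m\<^sup>2 + of_real (1 / c\<^sup>2))"
      unfolding poly_stieltjes_cubic diff by simp
    also have "cmod \<dots> = cmod (1 / (\<i> * of_real x) - 1 / ?z \<epsilon>) * cmod (of_real (1 - 2 / c) * ?m\<^sup>2 + of_real (1 / c\<^sup>2))"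
      by (rule norm_mult)
    also have "\<dots> \<le> g \<epsilon>"
      unfolding g_def
    proof (intro mult_left_mono)
      have "cmod (of_real (1 - 2 / c) * ?m\<^sup>2 + of_real (1 / c\<^sup>2))
          \<le> cmod (of_real (1 - 2 / c) * ?m\<^sup>2) + cmod (of_real (1 / c\<^sup>2))"
        by (rule norm_triangle_ineq)
      also have "\<dots> = \<bar>1 - 2 / c\<bar> * (cmod ?m)\<^sup>2 + 1 / c\<^sup>2"
        by (simp only: norm_mult norm_of_real norm_power) simp
      also have "\<dots> \<le> \<bar>1 - 2 / c\<bar> * B\<^sup>2 + 1 / c\<^sup>2"
        using B[OF z(1)[OF elim] z(2)[OF elim]] by (intro add_right_mono mult_left_mono power_mono) auto
      finally show "cmod (of_real (1 - 2 / c) * ?m\<^sup>2 + of_real (1 / c\<^sup>2)) \<le> \<bar>1 - 2 / c\<bar> * B\<^sup>2 + 1 / c\<^sup>2" .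
    qed auto
    finally have "root 3 (Re ?m ^ 3) \<le> root 3 (g \<epsilon>)" by simp
    then show ?case using Re_s_pos[OF z(1)[OF elim]] by (simp add: odd_real_root_power_cancel)
  qed
  ultimately show ?thesis by (rule Lim_null_comparison[rotated])
qed

lemma s_boundary_limit:
  assumes "x \<noteq> 0"
  shows "((\<lambda>\<epsilon>. Re (s (\<i> * of_real x - of_real \<epsilon>))) \<longlongrightarrow> pi * limit_density c x) (at_right 0)"
proof (cases "x \<in> support_set c")
  case False
  then show ?thesis using s_boundary_limit_outside[OF assms] by (simp add: limit_density_def)
qed (use s_boundary_limit_inside[OF assms] in simp)

text \<open>At \<open>z = 0\<close> the reciprocal cubic is
  \<open>w * (w\<^sup>2 + c\<^sup>2 - 2 * c)\<close>, with one positive root for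
  \<open>c < 2\<close>. The limit is taken over the whole half-plane: it serves both to bound
  \<open>s\<close> near 0 and to compare boundary values there.\<close>

lemma s_limit_0:
  assumes "c < 2"
  shows "(s \<longlongrightarrow> of_real (1 / sqrt (2 * c - c\<^sup>2))) (at 0 within {z. Re z < 0})"
proof -
  define w where "w = sqrt (2 * c - c\<^sup>2)"
  have "c * (2 - c) > 0" using c_pos assms by simp
  then have w: "w > 0" "w\<^sup>2 = 2 * c - c\<^sup>2"
    by (simp_all add: w_def algebra_simps power2_eq_square)
  let ?F = "at 0 within {z. Re z < 0}"
  have "((\<lambda>z. poly (reciprocal_cubic c z) (of_real w)) \<longlongrightarrow> poly (reciprocal_cubic c 0) (of_real w)) ?F"
    unfolding poly_reciprocal_cubic by (intro tendsto_intros)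
  moreover have "poly (reciprocal_cubic c 0) (of_real w) = of_real (w * (w\<^sup>2 + (c\<^sup>2 - 2 * c)))"
    unfolding poly_reciprocal_cubic by (simp add: algebra_simps power2_eq_square power3_eq_cube)
  ultimately have "((\<lambda>z. poly (reciprocal_cubic c z) (of_real w)) \<longlongrightarrow> 0) ?F"
    by (simp add: w(2))
  then obtain r where r: "\<And>z. poly (reciprocal_cubic c z) (r z) = 0" "(r \<longlongrightarrow> of_real w) ?F"
    using monic_poly_root_tendsto[OF monic_reciprocal_cubic[of c], of "\<lambda>z. z"] by auto
  have "((\<lambda>z. 1 / r z) \<longlongrightarrow> 1 / of_real w) ?F"
    using w(1) by (intro tendsto_intros r) auto
  moreover have left: "eventually (\<lambda>z. Re z < 0) ?F" by (simp add: eventually_at_filter)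
  have right: "eventually (\<lambda>z. Re (r z) > 0) ?F"
    using order_tendstoD(1)[OF tendsto_Re[OF r(2)], of 0] w(1) by simp
  have "eventually (\<lambda>z. 1 / r z = s z) ?F"
    using left right
  proof eventually_elim
    case (elim z)
    then have "Re (1 / r z) > 0" by (simp add: Re_divide add_pos_nonneg zero_less_divide_iff)
    moreover from this have "stieltjes_equation c z (1 / r z)"
      using r(1)[of z] by (simp add: stieltjes_equation_iff_reciprocal[OF c_pos])
    ultimately show ?case using s_unique elim by blast
  qed
  ultimately have "(s \<longlongrightarrow> 1 / of_real w) ?F" by (simp cong: tendsto_cong)
  then show ?thesis by (simp only: w_def of_real_divide of_real_1)
qed

text \<open>Closeness of \<open>s\<close> to its limit on a small half-disc passes to the boundary
  values, which are \<open>pi * limit_density c x\<close>; no expansion of the explicit formula is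
  required.\<close>

lemma limit_density_tendsto_0:
  assumes "c < 2"
  shows "(limit_density c \<longlongrightarrow> 1 / (pi * sqrt (2 * c - c\<^sup>2))) (at 0)"
proof -
  define L where "L = 1 / sqrt (2 * c - c\<^sup>2)"
  have "((\<lambda>x. pi * limit_density c x) \<longlongrightarrow> L) (at 0)"
  proof (rule tendstoI)
    fix e :: real assume e: "e > 0"
    \<comment> \<open>Half of \<open>e\<close>, because only a weak inequality survives the limit
      \<epsilon> to 0.\<close>
    obtain \<delta> where \<delta>: "\<delta> > 0" "\<And>z. Re z < 0 \<Longrightarrow> cmod z < \<delta> \<Longrightarrow> cmod (s z - of_real L) < e / 2"
      using tendstoD[OF s_limit_0[OF assms, folded L_def], of "e / 2"] e
      unfolding eventually_at dist_norm diff_0_right by force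
    have "dist (pi * limit_density c x) L < e" if "x \<noteq> 0" "\<bar>x\<bar> < \<delta>" for x
    proof -
      have "((\<lambda>\<epsilon>. \<bar>Re (s (\<i> * of_real x - of_real \<epsilon>)) - L\<bar>) \<longlongrightarrow> \<bar>pi * limit_density c x - L\<bar>) (at_right 0)"
        by (intro tendsto_intros s_boundary_limit that)
      moreover have "((\<lambda>\<epsilon>. cmod (\<i> * of_real x - of_real \<epsilon>)) \<longlongrightarrow> cmod (\<i> * of_real x - of_real 0)) (at_right 0)"
        by (intro tendsto_intros)
      then have "eventually (\<lambda>\<epsilon>. cmod (\<i> * of_real x - of_real \<epsilon>) < \<delta>) (at_right 0)"
        by (rule order_tendstoD) (use that in \<open>simp add: norm_mult\<close>)
      then have "eventually (\<lambda>\<epsilon>. \<bar>Re (s (\<i> * of_real x - of_real \<epsilon>)) - L\<bar> \<le> e / 2) (at_right 0)"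
        using eventually_at_right_less[of "0::real"]
      proof eventually_elim
        case (elim \<epsilon>)
        then have "cmod (s (\<i> * of_real x - of_real \<epsilon>) - of_real L) < e / 2" by (intro \<delta>) auto
        then show ?case
          using abs_Re_le_cmod[of "s (\<i> * of_real x - of_real \<epsilon>) - of_real L"] by simp
      qed
      ultimately have "\<bar>pi * limit_density c x - L\<bar> \<le> e / 2"
        by (rule tendsto_upperbound) simp
      then show ?thesis using e by (simp add: dist_real_def)
    qed
    then show "eventually (\<lambda>x. dist (pi * limit_density c x) L < e) (at 0)"
      using \<delta>(1) by (auto simp: eventually_at)
  qed
  then have "((\<lambda>x. pi * limit_density c x / pi) \<longlongrightarrow> L / pi) (at 0)" by (intro tendsto_intros) auto
  then show ?thesis by (simp add: L_def mult.commute)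
qed

text \<open>At real \<open>z\<close> the cubic has real coefficients, so uniqueness makes
  \<open>s z\<close> equal to its conjugate. The quadratic term
  \<open>c * (c - 2) * m\<^sup>2\<close> is nonnegative for \<open>c \<ge> 2\<close> and is
  dropped.\<close>

lemma s_negative_real:
  assumes "c \<ge> 2" "\<epsilon> > 0"
  shows "1 \<le> \<epsilon> * (c\<^sup>2 * Re (s (- of_real \<epsilon>)) ^ 3 + Re (s (- of_real \<epsilon>)))"
proof -
  let ?z = "- complex_of_real \<epsilon>"
  have z: "Re ?z < 0" using assms by simp
  have "cnj (of_real (c\<^sup>2) * ?z * s ?z ^ 3 + of_real (c\<^sup>2 - 2 * c) * (s ?z)\<^sup>2 + ?z * s ?z + 1) = 0"
    using s_equation[OF z] Re_s_pos[OF z] by (subst (asm) stieltjes_equation_iff_poly[OF c_pos]) auto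
  then have "stieltjes_equation c ?z (cnj (s ?z))"
    using Re_s_pos[OF z] by (subst stieltjes_equation_iff_poly[OF c_pos]) auto
  then have "cnj (s ?z) = s ?z" using s_unique[OF z] Re_s_pos[OF z] by simp
  then obtain m where m: "s ?z = of_real m" by (metis complex_cnj_cancel_iff Reals_cnj_iff Reals_cases)
  have "of_real (c\<^sup>2) * ?z * of_real m ^ 3 + of_real (c\<^sup>2 - 2 * c) * (of_real m)\<^sup>2 + ?z * of_real m + 1 = 0"
    using s_equation[OF z] Re_s_pos[OF z] by (subst (asm) stieltjes_equation_iff_poly[OF c_pos]) (auto simp: m)
  also have "of_real (c\<^sup>2) * ?z * of_real m ^ 3 + of_real (c\<^sup>2 - 2 * c) * (of_real m)\<^sup>2 + ?z * of_real m + 1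
      = complex_of_real (1 + c * (c - 2) * m\<^sup>2 - \<epsilon> * (c\<^sup>2 * m ^ 3 + m))"
    by (simp add: algebra_simps power2_eq_square)
  finally have "1 + c * (c - 2) * m\<^sup>2 - \<epsilon> * (c\<^sup>2 * m ^ 3 + m) = 0" by (simp only: of_real_eq_0_iff)
  moreover have "c * (c - 2) * m\<^sup>2 \<ge> 0" using assms by simp
  ultimately show ?thesis by (simp add: m)
qed

end

subsection \<open>The limiting density\<close>

text \<open>Continuity is expressed through \<open>deriv (cdf Ft)\<close>, since the formula
  \<open>limit_density\<close> is not meaningful at 0. The domain contains 0 exactly when
  \<open>c < 2\<close>.\<close>

theorem theorem5p2:
  fixes c :: real
    and M :: "'w measure" and p :: "nat \<Rightarrow> nat" and Z1 Z2 :: "nat \<Rightarrow> 'w \<Rightarrow> complex mat"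
    and F :: "complex measure" and Ft :: "real measure"
  assumes "c > 0"
    and "skew_ensemble c M p Z1 Z2"
    and "limiting_spectral_distribution M (\<lambda>n \<omega>. skew_matrix n (Z1 n \<omega>) (Z2 n \<omega>)) F"
    and "\<And>z. Re z < 0 \<Longrightarrow>
           {m. Re m > 0 \<and> stieltjes_equation c z m} = {stieltjes_transform F z}"
    and "real_distribution Ft"
    and "F = distr Ft borel (\<lambda>y. \<i> * of_real y)"
  shows "(\<forall>x. x \<noteq> 0 \<longrightarrow> (cdf Ft has_real_derivative limit_density c x) (at x)) \<and>
         (c < 2 \<longrightarrow> (cdf Ft has_real_derivative 1 / (pi * sqrt (2 * c - c\<^sup>2))) (at 0)) \<and>
         continuous_on {x. cdf Ft differentiable (at x)} (deriv (cdf Ft))"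
proof -
  interpret Ft: real_distribution Ft by fact
  interpret stieltjes_solution c "stieltjes_transform F"
    by unfold_locales (fact assms(1), fact assms(4))
  let ?s = "stieltjes_transform F"
  let ?z = "\<lambda>x \<epsilon>. \<i> * of_real x - complex_of_real \<epsilon>"
  have pois: "poisson_integral Ft \<epsilon> x = Re (?s (?z x \<epsilon>))" if "\<epsilon> > 0" for \<epsilon> x
    using Re_stieltjes_transform[OF assms(5) that, of x] by (simp add: assms(6))
  have z_left: "Re (?z x \<epsilon>) < 0" "cmod (?z x \<epsilon>) \<ge> \<bar>x\<bar>" if "\<epsilon> > 0" for x \<epsilon>
    using that abs_Im_le_cmod[of "?z x \<epsilon>"] by auto
  have lim: "((\<lambda>\<epsilon>. poisson_integral Ft \<epsilon> x) \<longlongrightarrow> pi * limit_density c x) (at_right 0)" if "x \<noteq> 0" for x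
    using s_boundary_limit[OF that]
    by (rule Lim_transform_eventually) (use eventually_at_right_less in eventually_elim, simp add: pois)
  have der: "(cdf Ft has_real_derivative limit_density c x) (at x)" if x: "x \<noteq> 0" for x
  proof -
    \<comment> \<open>Half the distance to 0 keeps the interval away from 0, where \<open>s\<close>
      is bounded.\<close>
    define h where "h = \<bar>x\<bar> / 2"
    have h: "h > 0" using x by (simp add: h_def)
    have far: "y \<noteq> 0" "\<bar>y\<bar> \<ge> h" if "y \<in> {x - h..x + h}" for y
      using that x by (auto simp: h_def abs_if split: if_splits)
    obtain B where B: "\<And>z. Re z < 0 \<Longrightarrow> cmod z \<ge> h \<Longrightarrow> cmod (?s z) \<le> B"
      using s_bounded[OF h] by blast
    show ?thesis
    proof (rule Ft.stieltjes_inversion_cdf[where e = 1 and a = "x - h" and b = "x + h" and B = B])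
      fix \<epsilon> y :: real assume *: "0 < \<epsilon>" "\<epsilon> < 1" "y \<in> {x - h..x + h}"
      have "Re (?s (?z y \<epsilon>)) \<le> cmod (?s (?z y \<epsilon>))" by (rule complex_Re_le_cmod)
      also have "\<dots> \<le> B" using z_left[OF *(1), of y] far[OF *(3)] by (intro B) linarith+
      finally show "poisson_integral Ft \<epsilon> y \<le> B" using pois * by simp
    next
      show "continuous_on {x - h..x + h} (limit_density c)"
        using far(1) by (intro continuous_on_subset[OF continuous_limit_density[OF c_pos]]) blast
    qed (use h lim far in auto)
  qed
  have der0: "(cdf Ft has_real_derivative 1 / (pi * sqrt (2 * c - c\<^sup>2))) (at 0)" if c2: "c < 2"
  proof -
    define f0 where "f0 = 1 / (pi * sqrt (2 * c - c\<^sup>2))"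
    \<comment> \<open>The density with its gap at 0 filled by the limit there, hence continuous
      everywhere.\<close>
    define g where "g = (limit_density c)(0 := f0)"
    define L where "L = complex_of_real (1 / sqrt (2 * c - c\<^sup>2))"
    obtain d where d: "d > 0" "\<And>z. Re z < 0 \<Longrightarrow> cmod z < d \<Longrightarrow> cmod (?s z - L) < 1"
      using tendstoD[OF s_limit_0[OF c2, folded L_def], of 1]
      unfolding eventually_at dist_norm diff_0_right by force
    have "continuous_on UNIV g"
      unfolding continuous_on_eq_continuous_at[OF open_UNIV]
    proof
      fix x :: real
      show "isCont g x"
      proof (cases "x = 0")
        case True
        have "(g \<longlongrightarrow> f0) (at 0)"
          using limit_density_tendsto_0[OF c2, folded f0_def]
          by (rule Lim_transform_eventually) (auto simp: g_def eventually_at_filter)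
        then show ?thesis using True by (simp add: isCont_def g_def)
      next
        case False
        then have "isCont (limit_density c) x"
          using continuous_limit_density[OF c_pos] by (simp add: continuous_on_eq_continuous_at open_Compl)
        then show ?thesis
          using False by (subst isCont_cong[where g = "limit_density c"])
            (auto simp: g_def eventually_nhds intro!: exI[of _ "- {0}"])
      qed
    qed
    then have cont: "continuous_on A g" for A by (rule continuous_on_subset) simp
    have "(cdf Ft has_real_derivative g 0) (at 0)"
    \<comment> \<open>\<open>d / 2 + d / 3 < d\<close> keeps all points
      \<open>?z y \<epsilon>\<close> in the half-disc where \<open>s\<close> is within 1 of
      \<open>L\<close>.\<close>
    proof (rule Ft.stieltjes_inversion_cdf[where e = "d / 2" and a = "- (d / 3)" and b = "d / 3" and B = "cmod L + 1"])
      fix \<epsilon> y :: real assume *: "0 < \<epsilon>" "\<epsilon> < d / 2" "y \<in> {- (d / 3)..d / 3}"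
      have "cmod (?z y \<epsilon>) \<le> cmod (\<i> * of_real y) + cmod (of_real \<epsilon>)" by (rule norm_triangle_ineq4)
      also have "\<dots> < d" using * d(1) by (auto simp: norm_mult abs_if)
      finally have "cmod (?s (?z y \<epsilon>) - L) < 1" using * by (intro d) auto
      moreover have "cmod (?s (?z y \<epsilon>)) \<le> cmod L + cmod (?s (?z y \<epsilon>) - L)"
        using norm_triangle_ineq[of L "?s (?z y \<epsilon>) - L"] by simp
      ultimately show "poisson_integral Ft \<epsilon> y \<le> cmod L + 1"
        using complex_Re_le_cmod[of "?s (?z y \<epsilon>)"] pois[OF *(1), of y] by linarith
    next
      have "AE x in lborel. x \<noteq> (0::real)" by (rule AE_lborel_singleton)
      then show "AE x in lborel. x \<in> {- (d / 3)..d / 3} \<longrightarrow>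
          ((\<lambda>\<epsilon>. poisson_integral Ft \<epsilon> x) \<longlongrightarrow> pi * g x) (at_right 0)"
        by eventually_elim (simp add: g_def lim)
    qed (use d(1) cont in auto)
    then show ?thesis by (simp add: g_def f0_def)
  qed
  have not_diff: "\<not> cdf Ft differentiable (at 0)" if c2: "c \<ge> 2"
  proof
    assume "cdf Ft differentiable (at 0)"
    then obtain K where K: "K > 0" "eventually (\<lambda>k. poisson_integral Ft (k ^ 6) 0 \<le> K / k) (at_right 0)"
      by (rule Ft.poisson_integral_bound_of_cdf_differentiable)
    \<comment> \<open>Inserting the bound \<open>K / k\<close> into \<open>s_negative_real\<close>
      at \<open>\<epsilon> = k ^ 6\<close> leaves only positive powers of \<open>k\<close>, which
      cannot stay above 1.\<close>
    have "((\<lambda>k. c\<^sup>2 * K ^ 3 * k ^ 3 + K * k ^ 5) \<longlongrightarrow> c\<^sup>2 * K ^ 3 * 0 ^ 3 + K * 0 ^ 5) (at_right 0)"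
      by (intro tendsto_intros)
    moreover have "eventually (\<lambda>k. 1 \<le> c\<^sup>2 * K ^ 3 * k ^ 3 + K * k ^ 5) (at_right 0)"
      using K(2) eventually_at_right_less[of "0::real"]
    proof eventually_elim
      case (elim k)
      let ?m = "Re (?s (- of_real (k ^ 6)))"
      have m: "0 \<le> ?m" "?m \<le> K / k"
        using elim pois[of "k ^ 6" 0] Re_s_pos[of "- of_real (k ^ 6)"] by auto
      have "1 \<le> k ^ 6 * (c\<^sup>2 * ?m ^ 3 + ?m)" using s_negative_real[OF c2, of "k ^ 6"] elim by simp
      also have "\<dots> \<le> k ^ 6 * (c\<^sup>2 * (K / k) ^ 3 + K / k)"
        using m elim by (intro mult_left_mono add_mono power_mono) auto
      also have "\<dots> = c\<^sup>2 * K ^ 3 * k ^ 3 + K * k ^ 5"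
        using elim by (simp add: field_simps eval_nat_numeral)
      finally show ?case .
    qed
    ultimately have "1 \<le> c\<^sup>2 * K ^ 3 * 0 ^ 3 + K * 0 ^ 5"
      by (rule tendsto_lowerbound) simp
    then show False by simp
  qed
  have "continuous_on {x. cdf Ft differentiable (at x)} (deriv (cdf Ft))"
    unfolding continuous_on_def
  proof
    fix x assume x: "x \<in> {x. cdf Ft differentiable (at x)}"
    have D: "deriv (cdf Ft) y = limit_density c y" if "y \<noteq> 0" for y
      using der[OF that] by (rule DERIV_imp_deriv)
    \<comment> \<open>The limit holds over a full punctured neighbourhood: it avoids 0, or can be
      shrunk to do so, and there the derivative is \<open>limit_density c\<close>.\<close>
    have "(deriv (cdf Ft) \<longlongrightarrow> deriv (cdf Ft) x) (at x)"
    proof (cases "x = 0")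
      case True
      then have c2: "c < 2" using not_diff x by force
      have "(deriv (cdf Ft) \<longlongrightarrow> 1 / (pi * sqrt (2 * c - c\<^sup>2))) (at 0)"
        using limit_density_tendsto_0[OF c2]
        by (rule Lim_transform_eventually) (auto simp: D eventually_at_filter)
      then show ?thesis using True DERIV_imp_deriv[OF der0[OF c2]] by simp
    next
      case False
      then have "(limit_density c \<longlongrightarrow> limit_density c x) (at x)"
        using continuous_limit_density[OF c_pos] by (simp add: continuous_on_eq_continuous_at open_Compl isCont_def)
      moreover have "eventually (\<lambda>y. y \<noteq> 0) (at x)"
        using False by (intro eventually_neq_at_within)
      then have "eventually (\<lambda>y. limit_density c y = deriv (cdf Ft) y) (at x)"
        by eventually_elim (simp add: D)
      ultimately show ?thesis unfolding D[OF False] by (rule Lim_transform_eventually)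
    qed
    then show "(deriv (cdf Ft) \<longlongrightarrow> deriv (cdf Ft) x) (at x within {x. cdf Ft differentiable (at x)})"
      by (rule tendsto_mono[OF at_le[OF subset_UNIV]])
  qed
  with der der0 show ?thesis by blast
qed

end
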